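(* Consider the system $x(t+1)=g(x(t),u(t))$, $t\in\mathbb{N}$, with state in $\mathcal{X}\subseteq\mathbb{R}^n$ and input in $\mathcal{U}\subseteq\mathbb{R}^m$, and let $M,N\in\mathbb{N}^*$. Let $\omega:\mathbb{R}^n\to\mathbb{R}_{\ge0}$ be a measurement function and $V$ a finite-step control Lyapunov function for the time step $M$, with associated admissible finite-step feedback $q:\mathcal{X}\to\mathcal{U}^M$ and decay function $\alpha$, so that $$V(x(M,\xi,u_q))\le\alpha(V(\xi))\qquad\text{for all }\xi\in\mathcal{X},\tag{D}$$ and let $\hat\kappa\in\mathcal{K}_\infty$ be such that $$V(g^i(\xi,q(\xi)))\le\hat\kappa(V(\xi))\qquad\text{for all }\xi\in\mathcal{X},\ i=1,\dots,M-1.\tag{T}$$ Consider the MPC scheme with stage cost $V$ and optimization horizon $N$ described in the context, and let $\mathcal{A}:=\omega^{-1}(0)$. Then the following statements hold. (i) If in (D) $\alpha(s)=cs$ with $c\in[0,1)$ and in (T) $\hat\kappa(r)=dr$ with $d>0$, then the MPC closed loop is asymptotically $\omega$-stable with respect to the optimization horizon $N$ in $\mathcal{A}$ for all $$N>2+\frac{\ln(\gamma-1)}{\ln\gamma-\ln(\gamma-1)}\qquad\text{with}\quad \gamma=\frac{Md}{1-c}.$$ (ii) If in (D) $\alpha(s)=cs$ with $c\in[0,1)$ and $\hat\kappa$ in (T) satisfies $\hat\kappa(r)\le p\max\{r^a,r^b\}$ for constants $a,b,p>0$, then the MPC scheme is semiglobally practically asymptotically $\omega$-stabilizing with respect to the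 optimization horizon $N$ in $\mathcal{A}$. (iii) There exists $\rho\in\mathcal{K}_\infty$ such that, if $V$ is replaced by $\widetilde V=\rho(V)$ in the optimal control problem of the MPC scheme, then the MPC scheme is semiglobally practically asymptotically $\omega$-stabilizing with respect to the optimization horizon $N$ in $\mathcal{A}$.
   Context: $\mathbb{N}$ are the nonnegative integers, $\mathbb{N}^*$ the positive integers. Class $\mathcal{K}$: continuous strictly increasing functions $\mathbb{R}_{\ge0}\to\mathbb{R}_{\ge0}$ vanishing at $0$; $\mathcal{K}_\infty$: unbounded class-$\mathcal{K}$ functions; $\mathcal{KL}$: continuous $\beta:\mathbb{R}_{\ge0}^2\to\mathbb{R}_{\ge0}$ with $\beta(\cdot,s)\in\mathcal{K}$ for each $s\geq 0$ and $\beta(r,\cdot)$ decreasing with $\beta(r,s)\to0$ as $s\to\infty$ for each $r\ge 0$. $\alpha<\mathrm{id}$ means $\alpha(s)<s$ for all $s>0$. Measurement function: a continuous $\omega:\mathbb{R}^n\to\mathbb{R}_{\ge0}$ with $\omega^{-1}(0)\ne\emptyset$. Standing assumptions on the system: $g:\mathcal{X}\times\mathcal{U}\to\mathbb{R}^n$ is continuous and $\mathcal{K}$-bounded on $(\mathcal X,\mathcal U)$, i.e. for measurement functions $\omega_1$ on $\mathbb{R}^n$ and $\omega_2$ on $\mathbb{R}^m$ there are $\kappa_1,\kappa_2\in\mathcal{K}$ with $\omega_1(g(\xi,\mu))\le\kappa_1(\omega_1(\xi))+\kappa_2(\omega_2(\mu))$ for all $\xi\in\mathcal{X},\mu\in\mathcal{U}$.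 $x(\cdot,\xi,\mathbf{u})$ denotes the solution with $x(0)=\xi$ and input sequence $\mathbf{u}$. For $\mathbf{u}_M=(u(0),\dots,u(M-1))\in\mathcal{U}^M$ put $g^1(\xi,\mathbf{u}_M)=g(\xi,u(0))$ and $g^{j+1}(\xi,\mathbf{u}_M)=g(g^j(\xi,\mathbf{u}_M),u(j))$, $j=1,\dots,M-1$. A map $q:\mathcal{X}\to\mathcal{U}^M$ is an admissible finite-step feedback (of length $M$, with respect to $\omega$) if for all $\xi\in\mathcal{X}$ and $j=1,\dots,M$: (1) $g^j(\xi,q(\xi))\in\mathcal{X}$; (2) there is $\kappa_j\in\mathcal{K}$ (independent of $\xi$) with $\omega(g^j(\xi,q(\xi)))\le\kappa_j(\omega(\xi))$ for all $\xi\in\mathcal X$. The closed-loop trajectory $x_q(\cdot)=x(\cdot,\xi,u_q)$ is given by $x_q(0)=\xi$ and $x_q(kM+j+1)=g^{j+1}(x_q(kM),q(x_q(kM)))$ for $k\in\mathbb{N}$, $j=0,\dots,M-1$, and $u_q$ is the resulting input sequence. A continuous $V:\mathbb{R}^n\to\mathbb{R}_{\ge0}$ with $\underline\alpha(\omega(\xi))\le V(\xi)\le\overline\alpha(\omega(\xi))$ for all $\xi\in\mathbb{R}^n$, where $\underline\alpha,\overline\alpha\in\mathcal{K}_\infty$, is a finite-step control Lyapunov function for the time step $M$ if there exist an admissible finite-step feedback $q:\mathcal{X}\to\mathcal{U}^M$ (the associated feedback) and $\alpha\in\mathcal{K}_\infty$, $\alpha<\mathrm{id}$ (the associated decay function),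 such that $V(x(M,\xi,u_q))\le\alpha(V(\xi))$ for all $\xi\in\mathcal{X}$. A function $\hat\kappa$ as in (T) always exists: (T) is easily verified for $\hat\kappa(r)=\max_{i=1,\dots,M-1}\overline\alpha\circ\kappa_i\circ\underline\alpha^{-1}(r)$, with $\kappa_i$ from property (2) of $q$. MPC scheme with stage cost $V$ and horizon $N$: for $\xi\in\mathcal{X}$ consider the optimal control problem of minimizing $\sum_{i=0}^{N-1}V(x(i,\xi,\mathbf{u}_N))$ over $\mathbf{u}_N=(u_0,\dots,u_{N-1})$ subject to, for all $j\in\{0,\dots,N-1\}$, $x(j+1)=g(x(j),u_j)$, $x(0)=\xi$, $u_j\in\mathcal{U}$, $g(x(j),u_j)\in\mathcal{X}$. It is a standing assumption that an optimal solution $\mathbf{u}_N^*=(u_0^*(\xi),\dots,u_{N-1}^*(\xi))$ exists. The MPC feedback is $\hat q_{\mathrm{MPC}}(\xi):=u_0^*(\xi)$, evaluated and applied at every time step; the closed-loop solution of $x(t+1)=g(x(t),\hat q_{\mathrm{MPC}}(x(t)))$, $x(0)=\xi$, is denoted $x_{\mathrm{MPC}(N)}(\cdot,\xi)$. The MPC closed loop with horizon $N$ is asymptotically $\omega$-stable in $\mathcal{A}=\omega^{-1}(0)$ if there is $\beta\in\mathcal{KL}$ with $\omega(x_{\mathrm{MPC}(N)}(t,\xi))\le\beta(\omega(\xi),t)$ for all $\xi\in\mathcal{X}$, $t\in\mathbb{N}$. The MPC scheme is semiglobally practically asymptotically $\omega$-stabilizing with respect to the optimization horizon $N$ in $\mathcal{A}=\omega^{-1}(0)$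 if there exists $\beta\in\mathcal{KL}$ such that: for each $\delta>0$ and $\Delta>\delta$ there exists $N_{\delta,\Delta}\in\mathbb{N}^*$ such that for all horizons $N\ge N_{\delta,\Delta}$ and all $\xi\in\mathcal{X}$ with $\omega(\xi)<\Delta$, $\omega(x_{\mathrm{MPC}(N)}(t,\xi))\le\max\{\beta(\omega(\xi),t),\delta\}$ for all $t\in\mathbb{N}$. *)

theory Defs
  imports "HOL-Analysis.Analysis"
begin

text \<open>Comparison functions live on the nonnegative reals; their values at negative arguments are
  irrelevant. Nonnegativity of the values follows from monotonicity and the value at 0.\<close>

definition class_K :: "(real \<Rightarrow> real) set" where
  "class_K = {f. continuous_on {0..} f \<and> strict_mono_on {0..} f \<and> f 0 = 0}"

definition class_Kinf :: "(real \<Rightarrow> real) set" where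
  "class_Kinf = {f \<in> class_K. \<not> bounded (f ` {0..})}"

text \<open>Decreasing is meant in the weak sense: the first section property forces
  \<open>\<beta> 0 s = 0\<close> for all \<open>s\<close>.\<close>

definition class_KL :: "(real \<Rightarrow> real \<Rightarrow> real) set" where
  "class_KL = {\<beta>. continuous_on ({0..} \<times> {0..}) (\<lambda>(r, s). \<beta> r s)
     \<and> (\<forall>s\<ge>0. (\<lambda>r. \<beta> r s) \<in> class_K)
     \<and> (\<forall>r\<ge>0. antimono_on {0..} (\<beta> r) \<and> (\<beta> r \<longlongrightarrow> 0) at_top)}"

definition measurement_function :: "('a::topological_space \<Rightarrow> real) \<Rightarrow> bool" where
  "measurement_function \<omega> \<longleftrightarrow> continuous_on UNIV \<omega> \<and> (\<forall>x. 0 \<le> \<omega> x) \<and> \<omega> -` {0} \<noteq> {}"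

definition K_bounded_on ::
  "'x set \<Rightarrow> 'u set \<Rightarrow> ('x \<Rightarrow> real) \<Rightarrow> ('u \<Rightarrow> real) \<Rightarrow> ('x \<Rightarrow> 'u \<Rightarrow> 'x) \<Rightarrow> bool" where
  "K_bounded_on X U \<omega>1 \<omega>2 g \<longleftrightarrow>
     (\<exists>\<kappa>1\<in>class_K. \<exists>\<kappa>2\<in>class_K. \<forall>\<xi>\<in>X. \<forall>\<mu>\<in>U. \<omega>1 (g \<xi> \<mu>) \<le> \<kappa>1 (\<omega>1 \<xi>) + \<kappa>2 (\<omega>2 \<mu>))"

text \<open>\<open>sol g \<xi> u t\<close> is \<open>x(t, \<xi>, u)\<close>. It reads only the first \<open>t\<close> entries of \<open>u\<close>, so a finite
  input sequence of length \<open>M\<close> is represented by any \<open>u\<close> through its entries below \<open>M\<close>, and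
  \<open>sol g \<xi> u j\<close> is then also \<open>g\<^sup>j(\<xi>, u)\<close> for \<open>1 \<le> j \<le> M\<close>.\<close>

primrec sol :: "('x \<Rightarrow> 'u \<Rightarrow> 'x) \<Rightarrow> 'x \<Rightarrow> (nat \<Rightarrow> 'u) \<Rightarrow> nat \<Rightarrow> 'x" where
  "sol g \<xi> u 0 = \<xi>"
| "sol g \<xi> u (Suc t) = g (sol g \<xi> u t) (u t)"

definition admissible_fs_feedback ::
  "('x \<Rightarrow> 'u \<Rightarrow> 'x) \<Rightarrow> 'x set \<Rightarrow> 'u set \<Rightarrow> nat \<Rightarrow> ('x \<Rightarrow> real) \<Rightarrow> ('x \<Rightarrow> nat \<Rightarrow> 'u) \<Rightarrow> bool" where
  "admissible_fs_feedback g X U M \<omega> q \<longleftrightarrow>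
     (\<forall>\<xi>\<in>X. \<forall>j<M. q \<xi> j \<in> U)
   \<and> (\<forall>\<xi>\<in>X. \<forall>j\<in>{1..M}. sol g \<xi> (q \<xi>) j \<in> X)
   \<and> (\<forall>j\<in>{1..M}. \<exists>\<kappa>\<in>class_K. \<forall>\<xi>\<in>X. \<omega> (sol g \<xi> (q \<xi>) j) \<le> \<kappa> (\<omega> \<xi>))"

text \<open>\<open>fs_block g M q \<xi> k\<close> is the closed-loop state \<open>x\<^sub>q(k M)\<close> and \<open>fs_input g M q \<xi>\<close> is the
  input sequence \<open>u\<^sub>q\<close> generated from the initial state \<open>\<xi>\<close>.\<close>

primrec fs_block :: "('x \<Rightarrow> 'u \<Rightarrow> 'x) \<Rightarrow> nat \<Rightarrow> ('x \<Rightarrow> nat \<Rightarrow> 'u) \<Rightarrow> 'x \<Rightarrow> nat \<Rightarrow> 'x" where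
  "fs_block g M q \<xi> 0 = \<xi>"
| "fs_block g M q \<xi> (Suc k) = sol g (fs_block g M q \<xi> k) (q (fs_block g M q \<xi> k)) M"

definition fs_input :: "('x \<Rightarrow> 'u \<Rightarrow> 'x) \<Rightarrow> nat \<Rightarrow> ('x \<Rightarrow> nat \<Rightarrow> 'u) \<Rightarrow> 'x \<Rightarrow> nat \<Rightarrow> 'u" where
  "fs_input g M q \<xi> t = q (fs_block g M q \<xi> (t div M)) (t mod M)"

lemma sol_fs_input_block:
  assumes "sol g \<xi> (fs_input g M q \<xi>) (k * M) = fs_block g M q \<xi> k" and "j \<le> M"
  shows "sol g \<xi> (fs_input g M q \<xi>) (k * M + j)
       = sol g (fs_block g M q \<xi> k) (q (fs_block g M q \<xi> k)) j"
  using assms(2)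
proof (induction j)
  case 0
  then show ?case using assms(1) by simp
next
  case (Suc j)
  then show ?case by (simp add: fs_input_def)
qed

lemma sol_fs_input_mult: "sol g \<xi> (fs_input g M q \<xi>) (k * M) = fs_block g M q \<xi> k"
proof (induction k)
  case (Suc k)
  then show ?case using sol_fs_input_block[OF Suc order.refl] by (simp add: add.commute)
qed simp

lemma sol_fs_input:
  assumes "j < M"
  shows "sol g \<xi> (fs_input g M q \<xi>) (k * M + j + 1)
       = sol g (sol g \<xi> (fs_input g M q \<xi>) (k * M)) (q (sol g \<xi> (fs_input g M q \<xi>) (k * M))) (j + 1)"
  using sol_fs_input_block[OF sol_fs_input_mult, of "j + 1" M] assms
  unfolding sol_fs_input_mult add.assoc by simp

definition fs_decay ::
  "('x \<Rightarrow> 'u \<Rightarrow> 'x) \<Rightarrow> 'x set \<Rightarrow> nat \<Rightarrow> ('x \<Rightarrow> real) \<Rightarrow> ('x \<Rightarrow> nat \<Rightarrow> 'u) \<Rightarrow> (real \<Rightarrow> real) \<Rightarrow> bool" where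
  "fs_decay g X M V q \<alpha> \<longleftrightarrow> (\<forall>\<xi>\<in>X. V (sol g \<xi> (fs_input g M q \<xi>) M) \<le> \<alpha> (V \<xi>))"

definition fs_clf ::
  "('x::topological_space \<Rightarrow> 'u \<Rightarrow> 'x) \<Rightarrow> 'x set \<Rightarrow> 'u set \<Rightarrow> nat \<Rightarrow> ('x \<Rightarrow> real) \<Rightarrow> ('x \<Rightarrow> real)
     \<Rightarrow> ('x \<Rightarrow> nat \<Rightarrow> 'u) \<Rightarrow> (real \<Rightarrow> real) \<Rightarrow> bool" where
  "fs_clf g X U M \<omega> V q \<alpha> \<longleftrightarrow>
     continuous_on UNIV V \<and> (\<forall>\<xi>. 0 \<le> V \<xi>)
   \<and> (\<exists>\<alpha>1\<in>class_Kinf. \<exists>\<alpha>2\<in>class_Kinf. \<forall>\<xi>. \<alpha>1 (\<omega> \<xi>) \<le> V \<xi> \<and> V \<xi> \<le> \<alpha>2 (\<omega> \<xi>))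
   \<and> admissible_fs_feedback g X U M \<omega> q
   \<and> \<alpha> \<in> class_Kinf \<and> (\<forall>s>0. \<alpha> s < s)
   \<and> fs_decay g X M V q \<alpha>"

definition ocp_feasible ::
  "('x \<Rightarrow> 'u \<Rightarrow> 'x) \<Rightarrow> 'x set \<Rightarrow> 'u set \<Rightarrow> nat \<Rightarrow> 'x \<Rightarrow> (nat \<Rightarrow> 'u) \<Rightarrow> bool" where
  "ocp_feasible g X U N \<xi> u \<longleftrightarrow> (\<forall>j<N. u j \<in> U \<and> g (sol g \<xi> u j) (u j) \<in> X)"

definition ocp_cost ::
  "('x \<Rightarrow> 'u \<Rightarrow> 'x) \<Rightarrow> ('x \<Rightarrow> real) \<Rightarrow> nat \<Rightarrow> 'x \<Rightarrow> (nat \<Rightarrow> 'u) \<Rightarrow> real" where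
  "ocp_cost g V N \<xi> u = (\<Sum>i<N. V (sol g \<xi> u i))"

definition ocp_optimal ::
  "('x \<Rightarrow> 'u \<Rightarrow> 'x) \<Rightarrow> 'x set \<Rightarrow> 'u set \<Rightarrow> ('x \<Rightarrow> real) \<Rightarrow> nat \<Rightarrow> 'x \<Rightarrow> (nat \<Rightarrow> 'u) \<Rightarrow> bool" where
  "ocp_optimal g X U V N \<xi> u \<longleftrightarrow>
     ocp_feasible g X U N \<xi> u
   \<and> (\<forall>v. ocp_feasible g X U N \<xi> v \<longrightarrow> ocp_cost g V N \<xi> u \<le> ocp_cost g V N \<xi> v)"

text \<open>Optimal input sequences need not be unique; the feedback picks the first entry of some
  optimal sequence at each state. Its existence entails that of optimal solutions on \<open>X\<close>.\<close>

definition mpc_feedback ::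
  "('x \<Rightarrow> 'u \<Rightarrow> 'x) \<Rightarrow> 'x set \<Rightarrow> 'u set \<Rightarrow> ('x \<Rightarrow> real) \<Rightarrow> nat \<Rightarrow> ('x \<Rightarrow> 'u) \<Rightarrow> bool" where
  "mpc_feedback g X U V N \<mu> \<longleftrightarrow> (\<forall>\<xi>\<in>X. \<exists>u. ocp_optimal g X U V N \<xi> u \<and> \<mu> \<xi> = u 0)"

primrec mpc_traj :: "('x \<Rightarrow> 'u \<Rightarrow> 'x) \<Rightarrow> ('x \<Rightarrow> 'u) \<Rightarrow> 'x \<Rightarrow> nat \<Rightarrow> 'x" where
  "mpc_traj g \<mu> \<xi> 0 = \<xi>"
| "mpc_traj g \<mu> \<xi> (Suc t) = g (mpc_traj g \<mu> \<xi> t) (\<mu> (mpc_traj g \<mu> \<xi> t))"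

definition asymptotically_stable ::
  "('x \<Rightarrow> 'u \<Rightarrow> 'x) \<Rightarrow> 'x set \<Rightarrow> ('x \<Rightarrow> real) \<Rightarrow> ('x \<Rightarrow> 'u) \<Rightarrow> bool" where
  "asymptotically_stable g X \<omega> \<mu> \<longleftrightarrow>
     (\<exists>\<beta>\<in>class_KL. \<forall>\<xi>\<in>X. \<forall>t. \<omega> (mpc_traj g \<mu> \<xi> t) \<le> \<beta> (\<omega> \<xi>) (real t))"

text \<open>Here \<open>\<mu> N\<close> is the feedback used with horizon \<open>N\<close>.\<close>

definition semiglobally_practically_stabilizing ::
  "('x \<Rightarrow> 'u \<Rightarrow> 'x) \<Rightarrow> 'x set \<Rightarrow> ('x \<Rightarrow> real) \<Rightarrow> (nat \<Rightarrow> 'x \<Rightarrow> 'u) \<Rightarrow> bool" where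
  "semiglobally_practically_stabilizing g X \<omega> \<mu> \<longleftrightarrow>
     (\<exists>\<beta>\<in>class_KL. \<forall>\<delta>>0. \<forall>\<Delta>>\<delta>. \<exists>N0\<ge>1. \<forall>N\<ge>N0. \<forall>\<xi>\<in>X. \<omega> \<xi> < \<Delta> \<longrightarrow>
        (\<forall>t. \<omega> (mpc_traj g (\<mu> N) \<xi> t) \<le> max (\<beta> (\<omega> \<xi>) (real t)) \<delta>))"

end

theory Submission
  imports Defs
begin

text \<open>The value function \<open>J\<close> of the optimal control problem is a Lyapunov function of the closed loop.
  The finite-step feedback yields \<open>V \<le> J \<le> B(V)\<close> with \<open>B\<close> independent of the horizon. Following an
  optimal trajectory \<open>x\<^sub>0, \<dots>, x\<^sub>N\<close> up to \<open>x\<^sub>j\<close> and then switching to the finite-step feedback gives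
  \<open>J(x\<^sub>1) \<le> J(x\<^sub>0) - V(x\<^sub>0) + B(V(x\<^sub>j)) - \<Sum>\<^sub>i\<^sub>\<ge>\<^sub>j V(x\<^sub>i)\<close> for every \<open>1 \<le> j < N\<close>.
  For linear \<open>B\<close> the best \<open>j\<close> makes the error a fixed fraction of \<open>V(x\<^sub>0)\<close>, provided the horizon satisfies
  the logarithmic bound. For general \<open>B\<close> some \<open>V(x\<^sub>j)\<close> is at most \<open>B(V(x\<^sub>0)) / (N - 1)\<close>, so on bounded
  sets the error vanishes as \<open>N\<close> grows. In (iii), \<open>\<rho>\<close> is chosen such that the costs
  along the finite-step feedback become summable.\<close>

section \<open>Comparison functions\<close>

lemma class_K_less: "f \<in> class_K \<Longrightarrow> 0 \<le> x \<Longrightarrow> x < y \<Longrightarrow> f x < f y"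
  unfolding class_K_def by (auto dest!: strict_mono_onD[of "{0..}" f x y])

lemma class_K_mono: "f \<in> class_K \<Longrightarrow> 0 \<le> x \<Longrightarrow> x \<le> y \<Longrightarrow> f x \<le> f y"
  using class_K_less[of f x y] by (cases "x = y") auto

lemma class_K_zero: "f \<in> class_K \<Longrightarrow> f 0 = 0"
  unfolding class_K_def by simp

lemma class_K_nonneg: "f \<in> class_K \<Longrightarrow> 0 \<le> x \<Longrightarrow> 0 \<le> f x"
  using class_K_mono[of f 0 x] by (simp add: class_K_zero)

lemma class_K_pos: "f \<in> class_K \<Longrightarrow> 0 < x \<Longrightarrow> 0 < f x"
  using class_K_less[of f 0 x] by (simp add: class_K_zero)

lemma class_K_le_iff: "f \<in> class_K \<Longrightarrow> 0 \<le> x \<Longrightarrow> 0 \<le> y \<Longrightarrow> f x \<le> f y \<longleftrightarrow> x \<le> y"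
  using class_K_mono[of f x y] class_K_less[of f y x] by linarith

lemma class_K_continuous: "f \<in> class_K \<Longrightarrow> continuous_on {0..} f"
  unfolding class_K_def by simp

lemma class_KI:
  assumes "continuous_on {0..} f" "\<And>x y. 0 \<le> x \<Longrightarrow> x < y \<Longrightarrow> f x < f y" "f 0 = 0"
  shows "f \<in> class_K"
  using assms unfolding class_K_def by (simp add: strict_mono_on_def)

lemma class_Kinf_imp_K: "f \<in> class_Kinf \<Longrightarrow> f \<in> class_K"
  unfolding class_Kinf_def by simp

text \<open>For monotone functions, being unbounded amounts to reaching every level. In this form
  the property composes easily and feeds the intermediate value theorem.\<close>

lemma class_Kinf_iff: "f \<in> class_Kinf \<longleftrightarrow> f \<in> class_K \<and> (\<forall>y. \<exists>x\<ge>0. y \<le> f x)"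
proof (cases "f \<in> class_K")
  case True
  have "bounded (f ` {0..}) \<longleftrightarrow> (\<exists>y. \<forall>x\<ge>0. f x < y)"
  proof
    assume "bounded (f ` {0..})"
    then obtain b where "\<forall>x\<in>{0..}. \<bar>f x\<bar> \<le> b"
      by (auto simp: bounded_iff)
    then have "f x < b + 1" if "0 \<le> x" for x
      using that by (smt (verit) atLeast_iff)
    then show "\<exists>y. \<forall>x\<ge>0. f x < y" by blast
  next
    assume "\<exists>y. \<forall>x\<ge>0. f x < y"
    then obtain y where "\<forall>x\<ge>0. f x < y" by blast
    then have "\<forall>x\<in>{0..}. \<bar>f x\<bar> \<le> y"
      using class_K_nonneg[OF True] by (auto simp: less_imp_le)
    then show "bounded (f ` {0..})"
      by (auto simp: bounded_iff)
  qed
  then show ?thesis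
    using True unfolding class_Kinf_def by (auto simp: not_less)
qed (simp add: class_Kinf_def)

lemma class_K_comp:
  assumes "f \<in> class_K" "g \<in> class_K"
  shows "(\<lambda>x. f (g x)) \<in> class_K"
proof (rule class_KI)
  show "continuous_on {0..} (\<lambda>x. f (g x))"
    using class_K_nonneg[OF assms(2)]
    by (intro continuous_on_compose2[OF class_K_continuous[OF assms(1)] class_K_continuous[OF assms(2)]])
      auto
qed (use assms in \<open>auto simp: class_K_zero class_K_less class_K_nonneg\<close>)

lemma class_Kinf_comp:
  assumes "f \<in> class_Kinf" "g \<in> class_Kinf"
  shows "(\<lambda>x. f (g x)) \<in> class_Kinf"
  unfolding class_Kinf_iff
proof (intro conjI allI)
  show "(\<lambda>x. f (g x)) \<in> class_K"
    using assms class_K_comp class_Kinf_imp_K by blast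
  fix y
  obtain z where z: "z \<ge> 0" "y \<le> f z" using assms(1) class_Kinf_iff by blast
  obtain x where x: "x \<ge> 0" "z \<le> g x" using assms(2) class_Kinf_iff by blast
  have "f z \<le> f (g x)"
    using class_K_mono[OF class_Kinf_imp_K[OF assms(1)]] z x by blast
  then show "\<exists>x\<ge>0. y \<le> f (g x)" using x z by force
qed

lemma class_Kinf_add:
  assumes "f \<in> class_Kinf" "g \<in> class_K"
  shows "(\<lambda>x. f x + g x) \<in> class_Kinf"
proof -
  have f: "f \<in> class_K" by (rule class_Kinf_imp_K[OF assms(1)])
  have "(\<lambda>x. f x + g x) \<in> class_K"
    using f assms(2)
    by (intro class_KI)
      (auto simp: class_K_zero class_K_less add_strict_mono class_K_continuous continuous_on_add)
  moreover have "\<exists>x\<ge>0. y \<le> f x + g x" for y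
  proof -
    obtain x where "x \<ge> 0" "y \<le> f x" using assms(1) class_Kinf_iff by blast
    then show ?thesis using class_K_nonneg[OF assms(2), of x] by force
  qed
  ultimately show ?thesis by (simp add: class_Kinf_iff)
qed

lemma class_Kinf_linear:
  fixes c :: real
  assumes "0 < c"
  shows "(\<lambda>x. c * x) \<in> class_Kinf"
  unfolding class_Kinf_iff
proof (intro conjI allI)
  show "(\<lambda>x. c * x) \<in> class_K"
    using assms by (intro class_KI continuous_on_mult_left continuous_on_id) auto
  fix y :: real
  show "\<exists>x\<ge>0. y \<le> c * x"
    using assms by (intro exI[of _ "\<bar>y\<bar> / c"]) auto
qed

lemma class_Kinf_cmult: "0 < c \<Longrightarrow> f \<in> class_Kinf \<Longrightarrow> (\<lambda>x. c * f x) \<in> class_Kinf"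
  using class_Kinf_comp[OF class_Kinf_linear] .

lemma class_Kinf_powr:
  assumes "0 < a"
  shows "(\<lambda>x. x powr a) \<in> class_Kinf"
  unfolding class_Kinf_iff
proof (intro conjI allI)
  show "(\<lambda>x. x powr a) \<in> class_K"
    using assms by (intro class_KI continuous_on_powr' continuous_intros) (auto intro: powr_less_mono2)
  fix y :: real
  show "\<exists>x\<ge>0. y \<le> x powr a"
    using assms by (intro exI[of _ "\<bar>y\<bar> powr (1 / a)"]) (auto simp: powr_powr)
qed

lemma class_Kinf_onto:
  assumes "f \<in> class_Kinf" "0 \<le> y"
  shows "\<exists>x\<ge>0. f x = y"
proof -
  have K: "f \<in> class_K" by (rule class_Kinf_imp_K[OF assms(1)])
  obtain b where "b \<ge> 0" "y \<le> f b" using assms(1) class_Kinf_iff by blast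
  then show ?thesis
    using IVT'[of f 0 y b] class_K_zero[OF K] assms(2)
      continuous_on_subset[OF class_K_continuous[OF K], of "{0..b}"] by auto
qed

lemma class_Kinf_inverse:
  assumes f: "f \<in> class_Kinf"
  obtains h where "h \<in> class_Kinf" "\<And>x. 0 \<le> x \<Longrightarrow> h (f x) = x" "\<And>y. 0 \<le> y \<Longrightarrow> f (h y) = y"
proof -
  have K: "f \<in> class_K" by (rule class_Kinf_imp_K[OF f])
  have inj: "inj_on f {0..}"
    using class_K_le_iff[OF K] by (auto intro!: inj_onI) (metis antisym order_refl)
  have img: "f ` {0..} = {0..}"
    using class_Kinf_onto[OF f] class_K_nonneg[OF K] by fastforce
  \<comment> \<open>Extending the inverse by the identity on the negative axis makes
    \<open>h\<close> a strictly increasing map onto the whole line. Continuity is then automatic,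
    since a monotone map with open range is continuous.\<close>
  define h where "h y = (if y < 0 then y else inv_into {0..} f y)" for y
  have fh: "f (h y) = y" and h0: "0 \<le> h y" if "0 \<le> y" for y
    using that f_inv_into_f[of y f "{0..}"] inv_into_into[of y f "{0..}"] img
    by (auto simp: h_def)
  have hf: "h (f x) = x" if "0 \<le> x" for x
    using that inv_into_f_f[OF inj, of x] class_K_nonneg[OF K that] by (simp add: h_def)
  have less: "h x < h y" if "x < y" for x y
  proof (cases "0 \<le> x")
    case True
    then show ?thesis
      using that class_K_le_iff[OF K h0 h0, of y x] fh by (force simp: not_le)
  next
    case False
    then show ?thesis using that h0[of y] by (auto simp: h_def not_le)
  qed
  have "range h = UNIV"
  proof (intro set_eqI iffI UNIV_I)
    fix x :: real
    show "x \<in> range h"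
    proof (cases "0 \<le> x")
      case True
      then show ?thesis using hf by (metis rangeI)
    next
      case False
      then have "x = h x" by (simp add: h_def)
      then show ?thesis by blast
    qed
  qed
  then have "continuous_on UNIV h"
    using less by (intro continuous_onI_mono) (auto intro: less_imp_le simp: le_less)
  then have "h \<in> class_K"
    using less hf[of 0] class_K_zero[OF K]
    by (intro class_KI) (auto intro: continuous_on_subset)
  moreover have "\<exists>x\<ge>0. y \<le> h x" for y
    using hf[of "\<bar>y\<bar>"] class_K_nonneg[OF K, of "\<bar>y\<bar>"] by (intro exI[of _ "f \<bar>y\<bar>"]) auto
  ultimately show thesis
    using that fh hf by (auto simp: class_Kinf_iff)
qed

lemma class_K_small:
  assumes "f \<in> class_K" "0 < e"
  obtains d where "0 < d" "\<And>x. 0 \<le> x \<Longrightarrow> x \<le> d \<Longrightarrow> f x \<le> e"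
proof -
  have "\<exists>d>0. \<forall>x\<in>{0..}. dist x 0 < d \<longrightarrow> dist (f x) (f 0) < e"
    using class_K_continuous[OF assms(1)] assms(2) unfolding continuous_on_iff by force
  then obtain d where d: "d > 0" "\<forall>x\<in>{0..}. dist x 0 < d \<longrightarrow> dist (f x) (f 0) < e" by blast
  have "f x \<le> e" if "0 \<le> x" "x \<le> d / 2" for x
    using d(2)[rule_format, of x] d(1) that class_K_zero[OF assms(1)]
    by (simp add: dist_real_def abs_less_iff)
  then show thesis using d(1) by (intro that[of "d / 2"]) auto
qed

text \<open>Every KL bound built below has this shape: \<open>G\<close> estimates the initial value
  function, the quotient is an average over the first \<open>1 + s\<close> stage costs, and
  \<open>F\<close> translates back to the measurement function.\<close>

lemma class_KL_quotient:
  assumes F: "F \<in> class_K" and G: "G \<in> class_K"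
  shows "(\<lambda>r s. F (G r / (1 + s))) \<in> class_KL"
  unfolding class_KL_def
proof (intro CollectI conjI allI impI)
  note contF = class_K_continuous[OF F] and contG = class_K_continuous[OF G]
  have "continuous_on ({0..} \<times> {0..}) (\<lambda>p. F (G (fst p) / (1 + snd p)))"
    by (intro continuous_on_compose2[OF contF] continuous_on_compose2[OF contG] continuous_intros)
      (auto simp: class_K_nonneg[OF G])
  then show "continuous_on ({0..} \<times> {0..}) (\<lambda>(r, s). F (G r / (1 + s)))"
    by (simp add: case_prod_unfold)
  show "(\<lambda>r. F (G r / (1 + s))) \<in> class_K" if "0 \<le> s" for s
  proof -
    have "(\<lambda>r. (1 / (1 + s)) * G r) \<in> class_K"
      using that by (intro class_K_comp[OF class_Kinf_imp_K[OF class_Kinf_linear] G]) auto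
    from class_K_comp[OF F this] show ?thesis by simp
  qed
  fix r :: real
  assume r: "0 \<le> r"
  show "antimono_on {0..} (\<lambda>s. F (G r / (1 + s)))"
    using class_K_nonneg[OF G r]
    by (auto intro!: monotone_onI class_K_mono[OF F] divide_left_mono)
  have "((\<lambda>s. G r / (1 + s)) \<longlongrightarrow> 0) at_top"
    by (intro real_tendsto_divide_at_top[OF tendsto_const] filterlim_tendsto_add_at_top[OF tendsto_const]
        filterlim_ident)
  then have "((\<lambda>s. F (G r / (1 + s))) \<longlongrightarrow> F 0) at_top"
    using class_K_nonneg[OF G r]
    by (intro continuous_on_tendsto_compose[OF contF])
      (auto intro: eventually_mono[OF eventually_ge_at_top[of 0]])
  then show "((\<lambda>s. F (G r / (1 + s))) \<longlongrightarrow> 0) at_top"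
    by (simp add: class_K_zero[OF F])
qed

section \<open>Optimal trajectories\<close>

text \<open>Inputs are total sequences, so concatenation restarts \<open>v\<close> at its index 0
  from time \<open>j\<close> on; the second trajectory then starts in the state reached at time
  \<open>j\<close>.\<close>

definition input_append :: "nat \<Rightarrow> (nat \<Rightarrow> 'u) \<Rightarrow> (nat \<Rightarrow> 'u) \<Rightarrow> nat \<Rightarrow> 'u" where
  "input_append j u v i = (if i < j then u i else v (i - j))"

lemma sol_input_append_le: "i \<le> j \<Longrightarrow> sol g \<xi> (input_append j u v) i = sol g \<xi> u i"
  by (induction i) (auto simp: input_append_def)

lemma sol_input_append_add:
  "sol g \<xi> (input_append j u v) (j + i) = sol g (sol g \<xi> u j) v i"
  by (induction i) (simp_all add: sol_input_append_le, simp add: input_append_def)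

lemma sol_Suc_shift: "sol g \<xi> u (Suc i) = sol g (g \<xi> (u 0)) (\<lambda>i. u (Suc i)) i"
  by (induction i) auto

lemma ocp_feasible_mono: "ocp_feasible g X U N \<xi> u \<Longrightarrow> j \<le> N \<Longrightarrow> ocp_feasible g X U j \<xi> u"
  by (auto simp: ocp_feasible_def)

lemma ocp_feasible_sol_in:
  assumes "ocp_feasible g X U N \<xi> u" "\<xi> \<in> X" "j \<le> N"
  shows "sol g \<xi> u j \<in> X"
  using assms by (cases j) (auto simp: ocp_feasible_def)

lemma ocp_feasible_append:
  assumes "ocp_feasible g X U j \<xi> u" "ocp_feasible g X U k (sol g \<xi> u j) v"
  shows "ocp_feasible g X U (j + k) \<xi> (input_append j u v)"
  unfolding ocp_feasible_def
proof (intro allI impI)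
  fix i
  assume "i < j + k"
  show "input_append j u v i \<in> U
    \<and> g (sol g \<xi> (input_append j u v) i) (input_append j u v i) \<in> X"
  proof (cases "i < j")
    case True
    then show ?thesis
      using assms(1) by (auto simp: ocp_feasible_def sol_input_append_le) (auto simp: input_append_def)
  next
    case False
    then obtain l where "i = j + l" "l < k"
      using \<open>i < j + k\<close> by (metis le_Suc_ex nat_add_left_cancel_less not_less)
    then show ?thesis
      using assms(2) by (auto simp: ocp_feasible_def sol_input_append_add) (auto simp: input_append_def)
  qed
qed

lemma ocp_cost_split:
  assumes "j \<le> N"
  shows "ocp_cost g V N \<xi> u = ocp_cost g V j \<xi> u + (\<Sum>i=j..<N. V (sol g \<xi> u i))"
  using assms unfolding ocp_cost_def lessThan_atLeast0 by (simp add: sum.atLeastLessThan_concat)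

lemma ocp_cost_append:
  "ocp_cost g V (j + k) \<xi> (input_append j u v)
    = ocp_cost g V j \<xi> u + ocp_cost g V k (sol g \<xi> u j) v"
proof -
  have "(\<Sum>i=j..<j+k. V (sol g \<xi> (input_append j u v) i))
      = (\<Sum>i<k. V (sol g \<xi> (input_append j u v) (j + i)))"
    using sum.shift_bounds_nat_ivl[of "\<lambda>i. V (sol g \<xi> (input_append j u v) i)" 0 j k]
    by (simp add: lessThan_atLeast0 add.commute)
  then show ?thesis
    by (subst ocp_cost_split[of j])
      (simp_all add: ocp_cost_def sol_input_append_le sol_input_append_add)
qed

text \<open>Principle of optimality: replacing the tail of an optimal input by \<open>v\<close>
  keeps the cost of the first \<open>j\<close> stages, which cancels in the comparison.\<close>

lemma optimal_tail_le:
  assumes "ocp_optimal g X U V N \<xi> u" "j \<le> N" "ocp_feasible g X U (N - j) (sol g \<xi> u j) v"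
  shows "(\<Sum>i=j..<N. V (sol g \<xi> u i)) \<le> ocp_cost g V (N - j) (sol g \<xi> u j) v"
proof -
  have feas: "ocp_feasible g X U N \<xi> u"
    using assms(1) by (simp add: ocp_optimal_def)
  have "ocp_feasible g X U N \<xi> (input_append j u v)"
    using ocp_feasible_append[OF ocp_feasible_mono[OF feas assms(2)] assms(3)] assms(2) by simp
  then have "ocp_cost g V N \<xi> u \<le> ocp_cost g V N \<xi> (input_append j u v)"
    using assms(1) by (simp add: ocp_optimal_def)
  also have "\<dots> = ocp_cost g V j \<xi> u + ocp_cost g V (N - j) (sol g \<xi> u j) v"
    using ocp_cost_append[of g V j "N - j"] assms(2) by simp
  finally show ?thesis
    using ocp_cost_split[OF assms(2), of g V \<xi> u] by simp
qed

text \<open>The competitor at the successor state follows the old optimal input, shifted by one, up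
  to the state at time \<open>j\<close> and then uses \<open>v\<close>. Since the horizon has moved
  by one step, \<open>v\<close> must cover \<open>N + 1 - j\<close> stages.\<close>

lemma optimal_successor_le:
  assumes "ocp_optimal g X U V N \<xi> u" "ocp_optimal g X U V N (g \<xi> (u 0)) u'"
    and "1 \<le> j" "j \<le> N" "ocp_feasible g X U (N + 1 - j) (sol g \<xi> u j) v"
  shows "ocp_cost g V N (g \<xi> (u 0)) u' \<le> ocp_cost g V N \<xi> u - V \<xi>
    + ocp_cost g V (N + 1 - j) (sol g \<xi> u j) v - (\<Sum>i=j..<N. V (sol g \<xi> u i))"
proof -
  obtain k where j: "j = Suc k" using assms(3) by (cases j) auto
  define s where "s = (\<lambda>i. u (Suc i))"
  define \<xi>' where "\<xi>' = g \<xi> (u 0)"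
  have sol: "sol g \<xi>' s i = sol g \<xi> u (Suc i)" for i
    unfolding s_def \<xi>'_def by (rule sol_Suc_shift[symmetric])
  have "ocp_feasible g X U N \<xi> u"
    using assms(1) by (simp add: ocp_optimal_def)
  then have "ocp_feasible g X U k \<xi>' s"
    using assms(4) unfolding ocp_feasible_def sol j by (simp add: s_def del: sol.simps)
  moreover have "ocp_feasible g X U (N - k) (sol g \<xi>' s k) v"
    using assms(5) by (simp add: sol j)
  ultimately have "ocp_feasible g X U N \<xi>' (input_append k s v)"
    using ocp_feasible_append[of g X U k \<xi>' s "N - k" v] assms(4) j by simp
  then have "ocp_cost g V N \<xi>' u' \<le> ocp_cost g V N \<xi>' (input_append k s v)"
    using assms(2) by (simp add: ocp_optimal_def \<xi>'_def)
  also have "\<dots> = ocp_cost g V k \<xi>' s + ocp_cost g V (N - k) (sol g \<xi>' s k) v"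
    using ocp_cost_append[of g V k "N - k"] assms(4) j by simp
  also have "ocp_cost g V k \<xi>' s = ocp_cost g V j \<xi> u - V \<xi>"
    unfolding ocp_cost_def sol j by (simp add: sum.lessThan_Suc_shift del: sum.lessThan_Suc)
  also have "ocp_cost g V j \<xi> u
      = ocp_cost g V N \<xi> u - (\<Sum>i=j..<N. V (sol g \<xi> u i))"
    using ocp_cost_split[OF assms(4), of g V \<xi> u] by simp
  finally show ?thesis unfolding sol by (simp add: j \<xi>'_def)
qed

section \<open>Cost bounds and one-step descent of the value function\<close>

definition cost_bound ::
  "('x \<Rightarrow> 'u \<Rightarrow> 'x) \<Rightarrow> 'x set \<Rightarrow> 'u set \<Rightarrow> ('x \<Rightarrow> real) \<Rightarrow> nat \<Rightarrow> (real \<Rightarrow> real) \<Rightarrow> bool" where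
  "cost_bound g X U V k B \<longleftrightarrow>
     (\<forall>\<xi>\<in>X. \<exists>v. ocp_feasible g X U k \<xi> v \<and> ocp_cost g V k \<xi> v \<le> B (V \<xi>))"

text \<open>A cost bound only provides some feasible input at each state of \<open>X\<close>.
  Feasible trajectories stay in \<open>X\<close>, so such an input exists at the state at time
  \<open>j\<close> and competes with the optimal tail.\<close>

lemma optimal_tail_bound:
  assumes "ocp_optimal g X U V N \<xi> u" "\<xi> \<in> X" "j \<le> N" "cost_bound g X U V (N - j) B"
  shows "(\<Sum>i=j..<N. V (sol g \<xi> u i)) \<le> B (V (sol g \<xi> u j))"
proof -
  have "sol g \<xi> u j \<in> X"
    using assms(1-3) ocp_feasible_sol_in by (auto simp: ocp_optimal_def)
  then obtain v where v: "ocp_feasible g X U (N - j) (sol g \<xi> u j) v"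
    "ocp_cost g V (N - j) (sol g \<xi> u j) v \<le> B (V (sol g \<xi> u j))"
    using assms(4) unfolding cost_bound_def by blast
  then show ?thesis using optimal_tail_le[OF assms(1,3) v(1)] by simp
qed

lemma optimal_cost_bound:
  assumes "ocp_optimal g X U V N \<xi> u" "\<xi> \<in> X" "cost_bound g X U V N B"
  shows "ocp_cost g V N \<xi> u \<le> B (V \<xi>)"
  using optimal_tail_bound[OF assms(1,2), of 0 B] assms(3)
  by (simp add: ocp_cost_def lessThan_atLeast0)

lemma ocp_cost_ge_stage:
  assumes "1 \<le> N" "\<And>x. 0 \<le> V x"
  shows "V \<xi> \<le> ocp_cost g V N \<xi> u"
  using assms member_le_sum[of 0 "{..<N}" "\<lambda>i. V (sol g \<xi> u i)"] by (simp add: ocp_cost_def)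

lemma optimal_successor_bound:
  assumes "ocp_optimal g X U V N \<xi> u" "ocp_optimal g X U V N (g \<xi> (u 0)) u'" "\<xi> \<in> X"
    and "1 \<le> j" "j \<le> N" "cost_bound g X U V (N + 1 - j) B"
  shows "ocp_cost g V N (g \<xi> (u 0)) u' \<le> ocp_cost g V N \<xi> u - V \<xi>
    + B (V (sol g \<xi> u j)) - (\<Sum>i=j..<N. V (sol g \<xi> u i))"
proof -
  have "sol g \<xi> u j \<in> X"
    using assms(1,3,5) ocp_feasible_sol_in by (auto simp: ocp_optimal_def)
  then obtain v where v: "ocp_feasible g X U (N + 1 - j) (sol g \<xi> u j) v"
    "ocp_cost g V (N + 1 - j) (sol g \<xi> u j) v \<le> B (V (sol g \<xi> u j))"
    using assms(6) unfolding cost_bound_def by blast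
  then show ?thesis using optimal_successor_le[OF assms(1,2,4,5) v(1)] by simp
qed

text \<open>If all gaps were larger than the claimed value \<open>T\<close>, the tail sums shifted
  by \<open>T\<close> would grow by the factor \<open>r\<close> at each step backwards in time. Over
  \<open>N - 1\<close> steps this exceeds what the assumed bound on the tail from index 1
  permits.\<close>

lemma exists_small_tail_gap:
  fixes V :: "nat \<Rightarrow> real"
  assumes "1 < \<gamma>" "2 \<le> N" "\<gamma> < (\<gamma> / (\<gamma> - 1)) ^ (N - 1)"
    and V0: "0 \<le> V 0" and tail: "(\<Sum>i=1..<N. V i) \<le> (\<gamma> - 1) * V 0"
  shows "\<exists>j\<in>{1..<N}. \<gamma> * V j - (\<Sum>i=j..<N. V i)
    \<le> (\<gamma> - 1) / ((\<gamma> / (\<gamma> - 1)) ^ (N - 1) - 1) * V 0"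
proof (rule ccontr)
  define r where "r = \<gamma> / (\<gamma> - 1)"
  \<comment> \<open>\<open>T\<close> solves
    \<open>(\<gamma> - 1) * V 0 + T = r ^ (N - 1) * T\<close>, the equality case of the geometric
    growth; the horizon condition makes the denominator positive.\<close>
  define T where "T = (\<gamma> - 1) / (r ^ (N - 1) - 1) * V 0"
  define W where "W j = (\<Sum>i=j..<N. V i)" for j
  have r: "1 < r" "r ^ (N - 1) > \<gamma>" using assms(1,3) by (auto simp: r_def field_simps)
  have T0: "0 \<le> T" using assms(1) r V0 by (auto simp: T_def)
  assume "\<not> ?thesis"
  then have gap: "\<gamma> * V j - W j > T" if "j \<in> {1..<N}" for j
    using that unfolding T_def r_def W_def by (auto simp: not_le)
  have step: "W j + T > r * (W (Suc j) + T)" if "j \<in> {1..<N}" for j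
  proof -
    have "V j = W j - W (Suc j)"
      using that by (simp add: W_def sum.atLeast_Suc_lessThan)
    then have "\<gamma> * V j = \<gamma> * W j - \<gamma> * W (Suc j)" by (simp add: right_diff_distrib)
    then have "(\<gamma> - 1) * (W j + T) > \<gamma> * (W (Suc j) + T)"
      using gap[OF that] by (simp add: algebra_simps)
    then show ?thesis using assms(1) by (simp add: r_def field_simps)
  qed
  have ind: "k < N \<Longrightarrow> W (N - k) + T \<ge> r ^ k * T" for k
  proof (induction k)
    case 0
    then show ?case by (simp add: W_def)
  next
    case (Suc k)
    have "r ^ Suc k * T \<le> r * (W (N - k) + T)"
      using Suc r by (simp add: mult.assoc)
    also have "\<dots> \<le> W (N - Suc k) + T"
      using step[of "N - Suc k"] Suc.prems by (simp add: Suc_diff_Suc less_imp_le)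
    finally show ?case .
  qed
  \<comment> \<open>The induction gives only a weak inequality, so the step from index 2 to index 1
    is done separately to keep it strict; this matters when \<open>T = 0\<close>.\<close>
  have "r ^ (N - 1) * T = r * (r ^ (N - 2) * T)"
    using assms(2) by (simp add: Suc_diff_Suc numeral_2_eq_2 flip: power_Suc mult.assoc)
  also have "\<dots> \<le> r * (W 2 + T)"
    using ind[of "N - 2"] assms(2) r by simp
  also have "\<dots> < W 1 + T"
    using step[of 1] assms(2) by (simp add: numeral_2_eq_2)
  also have "W 1 \<le> (\<gamma> - 1) * V 0" using tail by (simp add: W_def)
  also have "(\<gamma> - 1) * V 0 = (r ^ (N - 1) - 1) * T"
    using r assms(1) by (simp add: T_def)
  finally show False by (simp add: algebra_simps)
qed

lemma descent_linear:
  assumes "1 < \<gamma>" "2 \<le> N" "\<gamma> < (\<gamma> / (\<gamma> - 1)) ^ (N - 1)"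
    and "\<And>k. cost_bound g X U V k (\<lambda>r. \<gamma> * r)" "\<And>x. 0 \<le> V x"
    and "ocp_optimal g X U V N \<xi> u" "ocp_optimal g X U V N (g \<xi> (u 0)) u'" "\<xi> \<in> X"
  shows "ocp_cost g V N (g \<xi> (u 0)) u' \<le> ocp_cost g V N \<xi> u
    - (1 - (\<gamma> - 1) / ((\<gamma> / (\<gamma> - 1)) ^ (N - 1) - 1)) * V \<xi>"
proof -
  \<comment> \<open>The initial stage cost is part of the optimal cost, so the remaining stages are
    bounded with the constant \<open>\<gamma> - 1\<close> instead of
    \<open>\<gamma>\<close>.\<close>
  have "(\<Sum>i=0..<N. V (sol g \<xi> u i)) = V \<xi> + (\<Sum>i=1..<N. V (sol g \<xi> u i))"
    using assms(2) by (subst sum.atLeast_Suc_lessThan) auto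
  then have "(\<Sum>i=1..<N. V (sol g \<xi> u i)) \<le> (\<gamma> - 1) * V (sol g \<xi> u 0)"
    using optimal_tail_bound[OF assms(6,8) le0 assms(4)] by (simp add: algebra_simps)
  then obtain j where j: "j \<in> {1..<N}"
    "\<gamma> * V (sol g \<xi> u j) - (\<Sum>i=j..<N. V (sol g \<xi> u i))
      \<le> (\<gamma> - 1) / ((\<gamma> / (\<gamma> - 1)) ^ (N - 1) - 1) * V \<xi>"
    using exists_small_tail_gap[OF assms(1-3), of "\<lambda>i. V (sol g \<xi> u i)"] assms(5) by auto
  then show ?thesis
    using optimal_successor_bound[OF assms(6-8) _ _ assms(4), of j] by (simp add: algebra_simps)
qed

text \<open>With decay in a single step, the cost constants are geometric partial sums adapted to
  the remaining horizon. They imply that the last predicted stage cost is at most the first one.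
  Replacing this last stage by two feedback stages adds at most \<open>c\<close> times it, so every
  horizon \<open>N \<ge> 2\<close> suffices.\<close>

lemma descent_one_step:
  fixes c :: real
  assumes c: "0 \<le> c" "c < 1" and "2 \<le> N"
    and bound: "\<And>k. cost_bound g X U V k (\<lambda>r. (\<Sum>i<k. c ^ i) * r)" and V: "\<And>x. 0 \<le> V x"
    and opt: "ocp_optimal g X U V N \<xi> u" "ocp_optimal g X U V N (g \<xi> (u 0)) u'" "\<xi> \<in> X"
  shows "ocp_cost g V N (g \<xi> (u 0)) u' \<le> ocp_cost g V N \<xi> u - (1 - c) * V \<xi>"
proof -
  define b where "b k = (\<Sum>i<k. c ^ i)" for k
  define W where "W j = (\<Sum>i=j..<N. V (sol g \<xi> u i))" for j
  have b_Suc: "b (Suc k) = 1 + c * b k" for k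
    unfolding b_def by (simp add: sum.lessThan_Suc_shift sum_distrib_left del: sum.lessThan_Suc)
  have b0: "0 \<le> b k" for k using c by (simp add: b_def sum_nonneg)
  have tail: "W j \<le> b (N - j) * V (sol g \<xi> u j)" if "j \<le> N" for j
    using optimal_tail_bound[OF opt(1,3) that bound] by (simp add: W_def b_def)
  have tail0: "j < N \<Longrightarrow> W j \<le> b (N - j) * V \<xi>" for j
  proof (induction j)
    case 0
    then show ?case using tail[of 0] by simp
  next
    case (Suc j)
    define B where "B = b (N - Suc j)"
    have B: "b (N - j) = 1 + c * B"
      using Suc.prems b_Suc[of "N - Suc j"] by (simp add: Suc_diff_Suc B_def)
    have B0: "0 \<le> B" by (simp add: B_def b0)
    have "W j = V (sol g \<xi> u j) + W (Suc j)"
      using Suc.prems unfolding W_def by (subst sum.atLeast_Suc_lessThan) auto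
    \<comment> \<open>The bound \<open>W j \<le> (1 + c * B) * V (sol g \<xi> u j)\<close> forces
      the head of the tail to carry a fixed share of it; removing the head shrinks the tail by the
      ratio of \<open>c * B\<close> to \<open>1 + c * B\<close>.\<close>
    then have "(1 + c * B) * W (Suc j) \<le> c * B * W j"
      using tail[of j] Suc.prems by (simp add: B algebra_simps)
    also have "\<dots> \<le> c * B * ((1 + c * B) * V \<xi>)"
      using Suc B0 c by (intro mult_left_mono) (auto simp: B)
    also have "\<dots> \<le> B * ((1 + c * B) * V \<xi>)"
      using B0 c V[of \<xi>] by (intro mult_right_mono) (auto simp: mult_left_le_one_le)
    finally have "(1 + c * B) * W (Suc j) \<le> (1 + c * B) * (B * V \<xi>)"
      by (simp add: mult_ac)
    moreover have "0 < 1 + c * B"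
      using B0 c by (simp add: add_pos_nonneg)
    ultimately show ?case by (simp add: B_def mult_le_cancel_left_pos)
  qed
  have W_last: "W (N - 1) = V (sol g \<xi> u (N - 1))"
    using assms(3) by (cases N) (auto simp: W_def)
  have last: "V (sol g \<xi> u (N - 1)) \<le> V \<xi>"
    using tail0[of "N - 1"] W_last assms(3) by (simp add: b_def)
  \<comment> \<open>The switch happens at \<open>j = N - 1\<close>, which leaves two stages to fill,
    hence the constant \<open>b 2 = 1 + c\<close>.\<close>
  have "ocp_cost g V N (g \<xi> (u 0)) u' \<le> ocp_cost g V N \<xi> u - V \<xi>
      + b 2 * V (sol g \<xi> u (N - 1)) - W (N - 1)"
    using optimal_successor_bound[OF opt, of "N - 1", OF _ _ bound] assms(3)
    by (simp add: b_def W_def)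
  also have "\<dots> = ocp_cost g V N \<xi> u - V \<xi> + c * V (sol g \<xi> u (N - 1))"
    unfolding W_last by (simp add: b_def numeral_2_eq_2 algebra_simps)
  also have "\<dots> \<le> ocp_cost g V N \<xi> u - V \<xi> + c * V \<xi>"
    using last c by (simp add: mult_left_mono)
  finally show ?thesis by (simp add: algebra_simps)
qed

text \<open>The \<open>N - 1\<close> stage costs after the first add up to at most
  \<open>B R\<close>, so one of them is at most their average bound. Switching there costs at most
  \<open>\<epsilon>\<close>, and the replaced tail is nonnegative.\<close>

lemma descent_practical:
  assumes B: "B \<in> class_K" and bound: "\<And>k. cost_bound g X U V k B"
    and V: "\<And>x. 0 \<le> V x" and N: "2 \<le> N"
    and R: "V \<xi> \<le> R" "\<And>s. 0 \<le> s \<Longrightarrow> s \<le> B R / (real N - 1) \<Longrightarrow> B s \<le> \<epsilon>"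
    and opt: "ocp_optimal g X U V N \<xi> u" "ocp_optimal g X U V N (g \<xi> (u 0)) u'" "\<xi> \<in> X"
  shows "ocp_cost g V N (g \<xi> (u 0)) u' \<le> ocp_cost g V N \<xi> u - V \<xi> + \<epsilon>"
proof -
  have "\<exists>j\<in>{1..<N}. V (sol g \<xi> u j) \<le> B R / (real N - 1)"
  proof (rule ccontr)
    assume "\<not> ?thesis"
    then have "(\<Sum>i=1..<N. B R / (real N - 1)) < (\<Sum>i=1..<N. V (sol g \<xi> u i))"
      using N by (intro sum_strict_mono) (auto simp: not_le)
    also have "(\<Sum>i=1..<N. B R / (real N - 1)) = B R"
      using N by (simp add: of_nat_diff)
    also have "(\<Sum>i=1..<N. V (sol g \<xi> u i)) \<le> (\<Sum>i=0..<N. V (sol g \<xi> u i))"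
      using V by (intro sum_mono2) auto
    also have "\<dots> \<le> B (V \<xi>)"
      using optimal_tail_bound[OF opt(1,3) le0 bound] by simp
    also have "\<dots> \<le> B R" using class_K_mono[OF B V R(1)] .
    finally show False by simp
  qed
  then obtain j where j: "j \<in> {1..<N}" "V (sol g \<xi> u j) \<le> B R / (real N - 1)" by blast
  have "B (V (sol g \<xi> u j)) \<le> \<epsilon>" using R(2)[OF V j(2)] .
  moreover have "0 \<le> (\<Sum>i=j..<N. V (sol g \<xi> u i))" using V by (simp add: sum_nonneg)
  ultimately show ?thesis
    using optimal_successor_bound[OF opt _ _ bound, of j] j(1) by simp
qed

text \<open>The stage costs sum up to at most \<open>w 0 / \<nu>\<close>, so one of the first \<open>t + 1\<close> is at most
  \<open>w 0 / (\<nu> (t + 1))\<close>; from there on \<open>w\<close> cannot increase. This yields a class KL estimate without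
  iterating comparison functions.\<close>

lemma descent_sequence_bound:
  fixes v w :: "nat \<Rightarrow> real"
  assumes B: "B \<in> class_K" and \<nu>: "0 < \<nu>" "\<nu> \<le> 1"
    and vw: "\<And>i. i \<le> t \<Longrightarrow> 0 \<le> v i \<and> v i \<le> w i \<and> w i \<le> B (v i)"
    and desc: "\<And>i. i < t \<Longrightarrow> w (Suc i) \<le> w i - \<nu> * v i"
  shows "w t \<le> B (w 0 / \<nu> / (1 + real t))"
proof -
  have "j \<le> t \<Longrightarrow> \<nu> * (\<Sum>i<j. v i) \<le> w 0 - w j" for j
  proof (induction j)
    case (Suc j)
    then show ?case using desc[of j] by (simp add: algebra_simps)
  qed simp
  from this[of t] have "\<nu> * (\<Sum>i<Suc t. v i) \<le> w 0 - w t + \<nu> * v t"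
    by (simp add: algebra_simps)
  \<comment> \<open>Descent is assumed only before time \<open>t\<close>, so the stage cost at
    \<open>t\<close> itself is paid for by \<open>w t\<close>; this is where
    \<open>\<nu> \<le> 1\<close> enters.\<close>
  moreover have "\<nu> * v t \<le> w t"
    using vw[of t] \<nu> mult_left_le_one_le[of "v t" \<nu>] by simp
  ultimately have sum: "(\<Sum>i<Suc t. v i) \<le> w 0 / \<nu>"
    using \<nu> by (simp add: field_simps)
  have "\<exists>i<Suc t. v i \<le> w 0 / \<nu> / (1 + real t)"
  proof (rule ccontr)
    assume "\<not> ?thesis"
    then have "(\<Sum>i<Suc t. w 0 / \<nu> / (1 + real t)) < (\<Sum>i<Suc t. v i)"
      by (intro sum_strict_mono) (auto simp: not_le)
    moreover have "(\<Sum>i<Suc t. w 0 / \<nu> / (1 + real t)) = w 0 / \<nu>"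
      by (simp del: sum.lessThan_Suc)
    ultimately show False using sum by simp
  qed
  then obtain i where i: "i \<le> t" "v i \<le> w 0 / \<nu> / (1 + real t)"
    by (metis less_Suc_eq_le)
  have "w t \<le> w i"
  proof -
    have "i + k \<le> t \<Longrightarrow> w (i + k) \<le> w i" for k
    proof (induction k)
      case (Suc k)
      have "0 \<le> \<nu> * v (i + k)" using vw[of "i + k"] Suc.prems \<nu> by simp
      then show ?case using Suc desc[of "i + k"] by simp
    qed simp
    from this[of "t - i"] show ?thesis using i by simp
  qed
  also have "\<dots> \<le> B (v i)" using vw i by simp
  also have "\<dots> \<le> B (w 0 / \<nu> / (1 + real t))"
    using vw[OF i(1)] i(2) by (intro class_K_mono[OF B]) auto
  finally show ?thesis .
qed

section \<open>From descent of the value function to stability\<close>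

lemma mpc_feedback_optimal:
  assumes "mpc_feedback g X U V N \<mu>" "1 \<le> N"
  obtains us where "\<And>\<xi>. \<xi> \<in> X \<Longrightarrow> ocp_optimal g X U V N \<xi> (us \<xi>)"
    "\<And>\<xi>. \<xi> \<in> X \<Longrightarrow> \<mu> \<xi> = us \<xi> 0" "\<And>\<xi>. \<xi> \<in> X \<Longrightarrow> g \<xi> (\<mu> \<xi>) \<in> X"
proof -
  obtain us where us: "\<forall>\<xi>\<in>X. ocp_optimal g X U V N \<xi> (us \<xi>) \<and> \<mu> \<xi> = us \<xi> 0"
    using assms(1) unfolding mpc_feedback_def by metis
  moreover have "g \<xi> (\<mu> \<xi>) \<in> X" if "\<xi> \<in> X" for \<xi>
  proof -
    have "ocp_feasible g X U N \<xi> (us \<xi>)" "\<mu> \<xi> = us \<xi> 0"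
      using us that by (auto simp: ocp_optimal_def)
    then show ?thesis using assms(2) unfolding ocp_feasible_def
      by (metis less_eq_Suc_le One_nat_def sol.simps(1))
  qed
  ultimately show thesis using that by blast
qed

lemma mpc_traj_in:
  assumes "\<xi> \<in> X" "\<And>\<xi>. \<xi> \<in> X \<Longrightarrow> g \<xi> (\<mu> \<xi>) \<in> X"
  shows "mpc_traj g \<mu> \<xi> t \<in> X"
  using assms by (induction t) auto

text \<open>The value function \<open>J\<close> lies between \<open>V\<close> and
  \<open>B (V)\<close> and decreases along the closed loop by a fixed fraction of \<open>V\<close>,
  so the sequence bound applies to it at once.\<close>

lemma asymptotically_stable_if_descent:
  assumes a1: "a1 \<in> class_Kinf" and a2: "a2 \<in> class_Kinf" and \<omega>: "\<And>x. 0 \<le> \<omega> x"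
    and V: "\<And>x. 0 \<le> V x" "\<And>x. a1 (\<omega> x) \<le> V x \<and> V x \<le> a2 (\<omega> x)"
    and \<nu>: "0 < \<nu>" "\<nu> \<le> 1" and B: "B \<in> class_Kinf" and N: "1 \<le> N"
    and bound: "cost_bound g X U V N B"
    and fb: "mpc_feedback g X U V N \<mu>"
    and desc: "\<And>\<xi> u u'. \<lbrakk>ocp_optimal g X U V N \<xi> u; ocp_optimal g X U V N (g \<xi> (u 0)) u'; \<xi> \<in> X\<rbrakk>
      \<Longrightarrow> ocp_cost g V N (g \<xi> (u 0)) u' \<le> ocp_cost g V N \<xi> u - \<nu> * V \<xi>"
  shows "asymptotically_stable g X \<omega> \<mu>"
proof -
  obtain h where h: "h \<in> class_Kinf" "\<And>x. 0 \<le> x \<Longrightarrow> h (a1 x) = x"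
    using class_Kinf_inverse[OF a1] by metis
  note KB = class_Kinf_imp_K[OF B] and Kh = class_Kinf_imp_K[OF h(1)]
    and Ka1 = class_Kinf_imp_K[OF a1]
  obtain us where us: "\<And>\<xi>. \<xi> \<in> X \<Longrightarrow> ocp_optimal g X U V N \<xi> (us \<xi>)"
    "\<And>\<xi>. \<xi> \<in> X \<Longrightarrow> \<mu> \<xi> = us \<xi> 0" "\<And>\<xi>. \<xi> \<in> X \<Longrightarrow> g \<xi> (\<mu> \<xi>) \<in> X"
    using mpc_feedback_optimal[OF fb N] by blast
  define J where "J \<xi> = ocp_cost g V N \<xi> (us \<xi>)" for \<xi>
  have J: "V \<xi> \<le> J \<xi>" "J \<xi> \<le> B (V \<xi>)" "J (g \<xi> (\<mu> \<xi>)) \<le> J \<xi> - \<nu> * V \<xi>" if "\<xi> \<in> X" for \<xi>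
    using ocp_cost_ge_stage[OF N V(1), where u = "us \<xi>"] optimal_cost_bound[OF us(1) that bound]
      desc[OF us(1) _ that] us that unfolding J_def by auto
  \<comment> \<open>The layers, from inside out: the initial value of \<open>J\<close> is at most
    \<open>B (a2 r)\<close>, the sequence bound divides by \<open>\<nu>\<close> and
    \<open>1 + s\<close> and applies \<open>B\<close>, and \<open>h\<close> undoes
    \<open>a1\<close>.\<close>
  define \<beta> where "\<beta> = (\<lambda>r s. h (B (1 / \<nu> * B (a2 r) / (1 + s))))"
  have "\<beta> \<in> class_KL"
    unfolding \<beta>_def using \<nu>
    by (intro class_KL_quotient class_K_comp[OF Kh KB] class_Kinf_imp_K class_Kinf_cmult
        class_Kinf_comp[OF B a2]) auto
  moreover have "\<omega> (mpc_traj g \<mu> \<xi> t) \<le> \<beta> (\<omega> \<xi>) (real t)" if "\<xi> \<in> X" for \<xi> t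
  proof -
    define x where "x = mpc_traj g \<mu> \<xi>"
    have x: "x i \<in> X" for i unfolding x_def by (rule mpc_traj_in[of \<xi> X g \<mu>, OF that us(3)])
    have "J (x t) \<le> B (J (x 0) / \<nu> / (1 + real t))"
      using x V(1) J \<nu> unfolding x_def
      by (intro descent_sequence_bound[OF KB, where v = "\<lambda>i. V (mpc_traj g \<mu> \<xi> i)"
            and w = "\<lambda>i. J (mpc_traj g \<mu> \<xi> i)"]) auto
    also have "\<dots> \<le> B (1 / \<nu> * B (a2 (\<omega> \<xi>)) / (1 + real t))"
    proof (intro class_K_mono[OF KB])
      have "0 \<le> J \<xi>" using J(1)[OF that] V(1)[of \<xi>] by simp
      then show "0 \<le> J (x 0) / \<nu> / (1 + real t)" using \<nu> by (simp add: x_def)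
      have "J \<xi> \<le> B (a2 (\<omega> \<xi>))"
        using J(2)[OF that] class_K_mono[OF KB V(1)] V(2) by (meson order_trans)
      then show "J (x 0) / \<nu> / (1 + real t) \<le> 1 / \<nu> * B (a2 (\<omega> \<xi>)) / (1 + real t)"
        using \<nu> by (simp add: x_def divide_right_mono)
    qed
    finally have "a1 (\<omega> (x t)) \<le> \<dots>"
      using J(1)[OF x, of t] V(2)[of "x t"] by linarith
    then have "h (a1 (\<omega> (x t))) \<le> \<beta> (\<omega> \<xi>) (real t)"
      unfolding \<beta>_def using class_K_nonneg[OF Ka1 \<omega>] by (intro class_K_mono[OF Kh])
    then show ?thesis using h(2)[OF \<omega>] by (simp add: x_def)
  qed
  ultimately show ?thesis unfolding asymptotically_stable_def by blast
qed

text \<open>For long horizons \<open>J\<close> decreases by \<open>V\<close> up to an error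
  \<open>\<epsilon>\<close>. Outside a small sublevel set of \<open>J\<close> this error is less
  than half of \<open>V\<close>, so the previous argument runs with the fraction 1/2; the sublevel
  set itself is never left again.\<close>

lemma semiglobally_practically_stabilizing_if_cost_bound:
  assumes a1: "a1 \<in> class_Kinf" and a2: "a2 \<in> class_Kinf" and \<omega>: "\<And>x. 0 \<le> \<omega> x"
    and V: "\<And>x. 0 \<le> V x" "\<And>x. a1 (\<omega> x) \<le> V x \<and> V x \<le> a2 (\<omega> x)"
    and B: "B \<in> class_Kinf" and bound: "\<And>k. cost_bound g X U V k B"
    and fb: "\<And>N. 1 \<le> N \<Longrightarrow> mpc_feedback g X U V N (\<mu> N)"
  shows "semiglobally_practically_stabilizing g X \<omega> \<mu>"
proof -
  obtain h where h: "h \<in> class_Kinf" "\<And>x. 0 \<le> x \<Longrightarrow> h (a1 x) = x"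
    using class_Kinf_inverse[OF a1] by metis
  note KB = class_Kinf_imp_K[OF B] and Kh = class_Kinf_imp_K[OF h(1)]
    and Ka1 = class_Kinf_imp_K[OF a1] and Ka2 = class_Kinf_imp_K[OF a2]
  \<comment> \<open>The factor 2 is the reciprocal of the fraction 1/2. Nothing here refers to
    \<open>\<delta>\<close> or \<open>\<Delta>\<close>, as required by the order of
    quantifiers.\<close>
  define \<beta> where "\<beta> = (\<lambda>r s. h (B (2 * B (a2 r) / (1 + s))))"
  have KL: "\<beta> \<in> class_KL"
    unfolding \<beta>_def
    by (intro class_KL_quotient class_K_comp[OF Kh KB] class_Kinf_imp_K class_Kinf_cmult
        class_Kinf_comp[OF B a2]) auto
  have main: "\<exists>N0\<ge>1. \<forall>N\<ge>N0. \<forall>\<xi>\<in>X. \<omega> \<xi> < \<Delta> \<longrightarrow>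
        (\<forall>t. \<omega> (mpc_traj g (\<mu> N) \<xi> t) \<le> max (\<beta> (\<omega> \<xi>) (real t)) \<delta>)"
    if "0 < \<delta>" "\<delta> < \<Delta>" for \<delta> \<Delta>
  proof -
    \<comment> \<open>\<open>J \<le> \<eta>\<close> implies that the measurement is at most
      \<open>\<delta>\<close>. The level \<open>R\<close> contains both this target set and all
      initial states under consideration.\<close>
    define \<eta> where "\<eta> = a1 \<delta>"
    define R where "R = max (B (a2 \<Delta>)) \<eta>"
    have \<eta>: "0 < \<eta>" unfolding \<eta>_def by (rule class_K_pos[OF Ka1 that(1)])
    \<comment> \<open>\<open>\<epsilon>\<close> is chosen so that one step from a state with
      \<open>V \<le> 2 * \<epsilon>\<close>, where \<open>J \<le> B (2 * \<epsilon>)\<close>, ends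
      with \<open>J \<le> \<eta>\<close>.\<close>
    have "(\<lambda>s. B (2 * s) + 1 * s) \<in> class_K"
      by (intro class_Kinf_imp_K class_Kinf_add class_Kinf_comp[OF B] class_Kinf_linear) auto
    from class_K_small[OF this \<eta>] obtain \<epsilon> where \<epsilon>: "0 < \<epsilon>" "B (2 * \<epsilon>) + \<epsilon> \<le> \<eta>"
      by (metis less_imp_le mult_1 order_refl)
    obtain e where e: "0 < e" "\<And>s. 0 \<le> s \<Longrightarrow> s \<le> e \<Longrightarrow> B s \<le> \<epsilon>"
      using class_K_small[OF KB \<epsilon>(1)] by blast
    \<comment> \<open>This guarantees \<open>N \<ge> 2\<close> and brings the average
      \<open>B R / (real N - 1)\<close> below \<open>e\<close>.\<close>
    define N0 where "N0 = nat \<lceil>B R / e\<rceil> + 2"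
    have "\<omega> (mpc_traj g (\<mu> N) \<xi> t) \<le> max (\<beta> (\<omega> \<xi>) (real t)) \<delta>"
      if "N0 \<le> N" "\<xi> \<in> X" "\<omega> \<xi> < \<Delta>" for N \<xi> t
    proof -
      have N: "2 \<le> N" "1 \<le> N" using that(1) by (auto simp: N0_def)
      have "B R / e \<le> real N - 1"
        using that(1) by (simp add: N0_def) linarith
      then have e': "B R / (real N - 1) \<le> e"
        using e(1) N by (simp add: field_simps)
      obtain us where us: "\<And>\<xi>. \<xi> \<in> X \<Longrightarrow> ocp_optimal g X U V N \<xi> (us \<xi>)"
        "\<And>\<xi>. \<xi> \<in> X \<Longrightarrow> \<mu> N \<xi> = us \<xi> 0" "\<And>\<xi>. \<xi> \<in> X \<Longrightarrow> g \<xi> (\<mu> N \<xi>) \<in> X"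
        using mpc_feedback_optimal[OF fb[OF N(2)] N(2)] by blast
      define J where "J \<xi> = ocp_cost g V N \<xi> (us \<xi>)" for \<xi>
      have J: "V y \<le> J y" "J y \<le> B (V y)" if "y \<in> X" for y
        using ocp_cost_ge_stage[OF N(2) V(1), where u = "us y"]
          optimal_cost_bound[OF us(1) that bound] that unfolding J_def by auto
      have step: "J (g y (\<mu> N y)) \<le> J y - V y + \<epsilon>" if "y \<in> X" "J y \<le> R" for y
      proof -
        have "V y \<le> R" using J(1)[OF that(1)] that(2) by simp
        moreover have "B s \<le> \<epsilon>" if "0 \<le> s" "s \<le> B R / (real N - 1)" for s
          using that e' by (intro e(2)) auto
        moreover have "ocp_optimal g X U V N (g y (us y 0)) (us (g y (us y 0)))"
          using us that(1) by metis
        ultimately have "ocp_cost g V N (g y (us y 0)) (us (g y (us y 0)))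
            \<le> ocp_cost g V N y (us y) - V y + \<epsilon>"
          using descent_practical[OF KB bound V(1) N(1)] us(1)[OF that(1)] that(1) by blast
        then show ?thesis
          unfolding J_def us(2)[OF that(1)] .
      qed
      define x where "x = mpc_traj g (\<mu> N) \<xi>"
      have x: "x i \<in> X" for i unfolding x_def by (rule mpc_traj_in[of \<xi> X g "\<mu> N", OF that(2) us(3)])
      have x0: "J (x 0) \<le> B (a2 (\<omega> \<xi>))"
        using J(2)[OF that(2)] class_K_mono[OF KB V(1), of \<xi> "a2 (\<omega> \<xi>)"] V(2)[of \<xi>]
        by (simp add: x_def)
      have x_Suc: "x (Suc i) = g (x i) (\<mu> N (x i))" for i by (simp add: x_def)
      \<comment> \<open>The invariant records that either the target set has been reached, or proper
        descent has held at all earlier steps. The bound by \<open>R\<close> is carried along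
        because the descent estimate is only available on that level set.\<close>
      have "J (x t) \<le> R \<and> (J (x t) \<le> \<eta> \<or> (\<forall>i<t. J (x (Suc i)) \<le> J (x i) - 1 / 2 * V (x i)))"
        for t
      proof (induction t)
        case 0
        have "B (a2 (\<omega> \<xi>)) \<le> B (a2 \<Delta>)"
          using \<omega>[of \<xi>] that(3) class_K_nonneg[OF Ka2 \<omega>]
          by (intro class_K_mono[OF KB] class_K_mono[OF Ka2]) auto
        then show ?case using x0 by (simp add: R_def)
      next
        case (Suc t)
        have s: "J (x (Suc t)) \<le> J (x t) - V (x t) + \<epsilon>"
          using step[OF x] Suc x_Suc by simp
        have small: "J (x t) \<le> B (2 * \<epsilon>)" if "V (x t) \<le> 2 * \<epsilon>"
          using J(2)[OF x, of t] class_K_mono[OF KB V(1) that] by simp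
        show ?case
        proof (cases "J (x t) \<le> \<eta>")
          case True
          have "J (x (Suc t)) \<le> \<eta>"
          proof (cases "V (x t) \<le> 2 * \<epsilon>")
            case True
            then show ?thesis using s small \<epsilon>(2) V(1)[of "x t"] by simp
          next
            case False
            then show ?thesis using s \<open>J (x t) \<le> \<eta>\<close> \<epsilon>(1) by simp
          qed
          then show ?thesis by (simp add: R_def)
        next
          case False
          \<comment> \<open>Otherwise \<open>J \<le> B (2 * \<epsilon>)\<close>, which lies below
            \<open>\<eta>\<close>. Hence the error \<open>\<epsilon>\<close> is less than half of
            \<open>V\<close>.\<close>
          then have "2 * \<epsilon> < V (x t)" using small \<epsilon> by fastforce
          then have d: "J (x (Suc t)) \<le> J (x t) - 1 / 2 * V (x t)" using s by simp
          then have "J (x (Suc t)) \<le> R" using Suc V(1)[of "x t"] by simp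
          then show ?thesis using d Suc False by (auto simp: less_Suc_eq)
        qed
      qed
      then consider "J (x t) \<le> \<eta>" | "\<And>i. i < t \<Longrightarrow> J (x (Suc i)) \<le> J (x i) - 1 / 2 * V (x i)"
        by blast
      then show ?thesis
      proof cases
        case 1
        then have "a1 (\<omega> (x t)) \<le> a1 \<delta>"
          using J(1)[OF x, of t] V(2)[of "x t"] unfolding \<eta>_def by linarith
        then have "\<omega> (x t) \<le> \<delta>"
          using class_K_le_iff[OF Ka1 \<omega>] \<open>0 < \<delta>\<close> by simp
        then show ?thesis by (simp add: x_def)
      next
        case 2
        have "J (x t) \<le> B (J (x 0) / (1 / 2) / (1 + real t))"
          using x V(1) J 2
          by (intro descent_sequence_bound[OF KB, where v = "\<lambda>i. V (x i)" and w = "\<lambda>i. J (x i)"]) auto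
        also have "\<dots> \<le> B (2 * B (a2 (\<omega> \<xi>)) / (1 + real t))"
        proof (intro class_K_mono[OF KB])
          have "0 \<le> J (x 0)" using J(1)[OF x, of 0] V(1)[of "x 0"] by simp
          then show "0 \<le> J (x 0) / (1 / 2) / (1 + real t)" by simp
          show "J (x 0) / (1 / 2) / (1 + real t) \<le> 2 * B (a2 (\<omega> \<xi>)) / (1 + real t)"
            using x0 by (simp add: divide_right_mono)
        qed
        finally have "a1 (\<omega> (x t)) \<le> \<dots>"
          using J(1)[OF x, of t] V(2)[of "x t"] by linarith
        then have "h (a1 (\<omega> (x t))) \<le> \<beta> (\<omega> \<xi>) (real t)"
          unfolding \<beta>_def using class_K_nonneg[OF Ka1 \<omega>] by (intro class_K_mono[OF Kh])
        then show ?thesis using h(2)[OF \<omega>] by (simp add: x_def)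
      qed
    qed
    then show ?thesis by (intro exI[of _ N0]) (auto simp: N0_def)
  qed
  show ?thesis
    unfolding semiglobally_practically_stabilizing_def using KL main by blast
qed

section \<open>Cost of the finite-step feedback\<close>

lemma fs_block_in:
  assumes "admissible_fs_feedback g X U M \<omega> q" "1 \<le> M" "\<xi> \<in> X"
  shows "fs_block g M q \<xi> k \<in> X"
  using assms by (induction k) (auto simp: admissible_fs_feedback_def)

lemma sol_fs_input_eq:
  assumes "i < M"
  shows "sol g \<xi> (fs_input g M q \<xi>) (k * M + i)
    = sol g (fs_block g M q \<xi> k) (q (fs_block g M q \<xi> k)) i"
  by (rule sol_fs_input_block[OF sol_fs_input_mult less_imp_le[OF assms]])

lemma ocp_feasible_fs_input:
  assumes "admissible_fs_feedback g X U M \<omega> q" "1 \<le> M" "\<xi> \<in> X"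
  shows "ocp_feasible g X U N \<xi> (fs_input g M q \<xi>)"
  unfolding ocp_feasible_def
proof (intro allI impI)
  fix t
  define k i where "k = t div M" and "i = t mod M"
  define y where "y = fs_block g M q \<xi> k"
  have t: "t = k * M + i" "i < M" using assms(2) by (auto simp: k_def i_def)
  have y: "y \<in> X" unfolding y_def by (rule fs_block_in[OF assms])
  have u: "fs_input g M q \<xi> t = q y i" by (simp add: fs_input_def y_def k_def i_def)
  have "g (sol g \<xi> (fs_input g M q \<xi>) t) (q y i) = sol g y (q y) (Suc i)"
    unfolding t(1) by (simp add: y_def sol_fs_input_eq[OF t(2)])
  then show "fs_input g M q \<xi> t \<in> U \<and> g (sol g \<xi> (fs_input g M q \<xi>) t) (fs_input g M q \<xi> t) \<in> X"
    using assms(1) y t(2) unfolding admissible_fs_feedback_def u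
    by (metis Suc_eq_plus1 Suc_leI atLeastAtMost_iff le_add2)
qed

lemma ocp_cost_fs_input_le:
  assumes "1 \<le> M" "\<And>x. 0 \<le> V x"
    and f: "\<And>k i. i < M \<Longrightarrow> V (sol g (fs_block g M q \<xi> k) (q (fs_block g M q \<xi> k)) i) \<le> f k"
  shows "ocp_cost g V N \<xi> (fs_input g M q \<xi>) \<le> real M * (\<Sum>k<N. f k)"
proof -
  define v where "v t = V (sol g \<xi> (fs_input g M q \<xi>) t)" for t
  \<comment> \<open>Nonnegative costs allow enlarging the range to \<open>N\<close> complete blocks
    of length \<open>M\<close>, which avoids an incomplete last block.\<close>
  have "(\<Sum>t<N. v t) \<le> (\<Sum>t<N * M. v t)"
    using assms(1,2) by (intro sum_mono2) (auto simp: v_def intro: less_le_trans)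
  also have "\<dots> = (\<Sum>k<N. \<Sum>t=k * M..<k * M + M. v t)"
    by (rule sum.nat_group[symmetric])
  also have "\<dots> \<le> (\<Sum>k<N. real M * f k)"
  proof (intro sum_mono)
    fix k
    have "v t \<le> f k" if "t \<in> {k * M..<k * M + M}" for t
    proof -
      from that have "t = k * M + (t - k * M)" "t - k * M < M" by auto
      then show ?thesis using f sol_fs_input_eq unfolding v_def by metis
    qed
    then show "(\<Sum>t=k * M..<k * M + M. v t) \<le> real M * f k"
      using sum_bounded_above[of "{k * M..<k * M + M}" v "f k"] by simp
  qed
  finally show ?thesis by (simp add: ocp_cost_def v_def sum_distrib_left)
qed

lemma fs_block_decay:
  assumes "admissible_fs_feedback g X U M \<omega> q" "1 \<le> M" "\<xi> \<in> X"
    and "fs_decay g X M V q \<alpha>" "\<And>x. 0 \<le> V x" "\<And>r s. 0 \<le> r \<Longrightarrow> r \<le> s \<Longrightarrow> \<alpha> r \<le> \<alpha> s"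
  shows "V (fs_block g M q \<xi> k) \<le> (\<alpha> ^^ k) (V \<xi>)"
proof (induction k)
  case (Suc k)
  have "V (fs_block g M q \<xi> (Suc k)) \<le> \<alpha> (V (fs_block g M q \<xi> k))"
    using assms(4) fs_block_in[OF assms(1-3), of k] sol_fs_input_mult[of g _ M q 1]
    unfolding fs_decay_def by force
  also have "\<dots> \<le> \<alpha> ((\<alpha> ^^ k) (V \<xi>))" using assms(5,6) Suc by blast
  finally show ?case by simp
qed simp

lemma fs_block_decay_linear:
  fixes c :: real
  assumes "admissible_fs_feedback g X U M \<omega> q" "1 \<le> M" "\<xi> \<in> X"
    and "fs_decay g X M V q (\<lambda>s. c * s)" "\<And>x. 0 \<le> V x" "0 \<le> c"
  shows "V (fs_block g M q \<xi> k) \<le> c ^ k * V \<xi>"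
proof -
  have "((\<lambda>s. c * s) ^^ k) r = c ^ k * r" for r
    by (induction k) auto
  then show ?thesis
    using fs_block_decay[OF assms(1-5), of k] assms(6) by (simp add: mult_left_mono)
qed

text \<open>This reduces a cost bound to bookkeeping: \<open>f k\<close> estimates the stage costs
  in block \<open>k\<close> through the initial cost, and \<open>B\<close> must dominate the sum
  over blocks for the given horizon.\<close>

lemma cost_bound_fs_feedback:
  assumes "admissible_fs_feedback g X U M \<omega> q" "1 \<le> M" "\<And>x. 0 \<le> V x"
    and "\<And>\<xi> k i. \<xi> \<in> X \<Longrightarrow> i < M
      \<Longrightarrow> V (sol g (fs_block g M q \<xi> k) (q (fs_block g M q \<xi> k)) i) \<le> f k (V \<xi>)"
    and "\<And>r. 0 \<le> r \<Longrightarrow> real M * (\<Sum>k<N. f k r) \<le> B r"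
  shows "cost_bound g X U V N B"
  unfolding cost_bound_def
proof
  fix \<xi> assume \<xi>: "\<xi> \<in> X"
  have "ocp_cost g V N \<xi> (fs_input g M q \<xi>) \<le> B (V \<xi>)"
    using ocp_cost_fs_input_le[of M V g q \<xi> "\<lambda>k. f k (V \<xi>)" N, OF assms(2,3) assms(4)[OF \<xi>]]
      assms(5)[OF assms(3)[of \<xi>]] by simp
  then show "\<exists>v. ocp_feasible g X U N \<xi> v \<and> ocp_cost g V N \<xi> v \<le> B (V \<xi>)"
    using ocp_feasible_fs_input[OF assms(1,2) \<xi>] by blast
qed

lemma geometric_partial_sum_le:
  fixes c :: real
  assumes "0 \<le> c" "c < 1"
  shows "(\<Sum>k<n. c ^ k) \<le> 1 / (1 - c)"
  using assms by (simp add: sum_gp_strict divide_right_mono)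

section \<open>Summable comparison functions\<close>

context
  fixes \<alpha> :: "real \<Rightarrow> real"
  assumes K: "\<alpha> \<in> class_K" and less_id: "\<And>s. 0 < s \<Longrightarrow> \<alpha> s < s"
begin

lemma iterate_nonneg: "0 \<le> s \<Longrightarrow> 0 \<le> (\<alpha> ^^ k) s"
  by (induction k) (auto intro: class_K_nonneg[OF K])

lemma iterate_mono: "0 \<le> r \<Longrightarrow> r \<le> s \<Longrightarrow> (\<alpha> ^^ k) r \<le> (\<alpha> ^^ k) s"
  by (induction k) (auto intro: class_K_mono[OF K] iterate_nonneg)

lemma le_id: "0 \<le> s \<Longrightarrow> \<alpha> s \<le> s"
  using less_id[of s] class_K_zero[OF K] by (cases "s = 0") auto

lemma iterate_decseq: "0 \<le> s \<Longrightarrow> decseq (\<lambda>k. (\<alpha> ^^ k) s)"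
  by (intro decseq_SucI) (simp add: le_id iterate_nonneg)

text \<open>The iterates decrease to a limit, which is a fixed point by continuity;
  \<open>\<alpha> < id\<close> leaves only 0.\<close>

lemma iterate_tendsto_0:
  assumes "0 \<le> s"
  shows "(\<lambda>k. (\<alpha> ^^ k) s) \<longlonglongrightarrow> 0"
proof -
  obtain L where L: "(\<lambda>k. (\<alpha> ^^ k) s) \<longlonglongrightarrow> L"
    using decseq_convergent[OF iterate_decseq[OF assms], of 0] iterate_nonneg[OF assms] by blast
  have L0: "0 \<le> L" using LIMSEQ_le_const[OF L] iterate_nonneg[OF assms] by blast
  have "(\<lambda>k. \<alpha> ((\<alpha> ^^ k) s)) \<longlonglongrightarrow> \<alpha> L"
    using continuous_on_tendsto_compose[OF class_K_continuous[OF K] L] L0 iterate_nonneg[OF assms]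
    by simp
  moreover have "(\<lambda>k. \<alpha> ((\<alpha> ^^ k) s)) \<longlonglongrightarrow> L"
    using LIMSEQ_Suc[OF L] by simp
  ultimately have "\<alpha> L = L" using LIMSEQ_unique by blast
  then have "L = 0" using less_id[of L] L0 by force
  then show ?thesis using L by simp
qed

lemma finite_iterate_ge: "0 \<le> s \<Longrightarrow> 0 < e \<Longrightarrow> finite {k. e \<le> (\<alpha> ^^ k) s}"
proof -
  assume "0 \<le> s" "0 < e"
  then have "\<forall>\<^sub>F k in sequentially. (\<alpha> ^^ k) s < e"
    using iterate_tendsto_0 by (intro order_tendstoD(2)) auto
  then obtain n where "\<forall>k\<ge>n. (\<alpha> ^^ k) s < e" unfolding eventually_sequentially by blast
  then have "{k. e \<le> (\<alpha> ^^ k) s} \<subseteq> {..<n}"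
    by (auto simp: not_le[symmetric])
  then show ?thesis by (rule finite_subset) simp
qed

text \<open>Counts, with sign, how many applications of \<open>\<alpha>\<close> separate \<open>s\<close> from 1. At \<open>s = 0\<close> the second
  set is infinite, whence the separate case.\<close>

definition halving_weight :: "real \<Rightarrow> real" where
  "halving_weight s = (if s \<le> 0 then 0
     else 2 ^ card {k. 1 < (\<alpha> ^^ k) s} / 2 ^ card {k. s \<le> (\<alpha> ^^ k) 1})"

lemma halving_weight_nonneg: "0 \<le> halving_weight s"
  by (simp add: halving_weight_def)

lemma halving_weight_pos: "0 < s \<Longrightarrow> 0 < halving_weight s"
  by (simp add: halving_weight_def)

lemma finite_iterate_gt_1: "0 \<le> s \<Longrightarrow> finite {k. 1 < (\<alpha> ^^ k) s}"
  by (rule finite_subset[OF _ finite_iterate_ge[of s 1]]) auto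

lemma halving_weight_mono:
  assumes "r \<le> s"
  shows "halving_weight r \<le> halving_weight s"
proof (cases "r \<le> 0")
  case True
  then show ?thesis using halving_weight_nonneg[of s] by (simp add: halving_weight_def)
next
  case False
  have "card {k. 1 < (\<alpha> ^^ k) r} \<le> card {k. 1 < (\<alpha> ^^ k) s}"
    using False assms iterate_mono[of r s] finite_iterate_gt_1[of s]
    by (intro card_mono) (auto intro: less_le_trans)
  moreover have "card {k. s \<le> (\<alpha> ^^ k) 1} \<le> card {k. r \<le> (\<alpha> ^^ k) 1}"
    using False assms finite_iterate_ge[of 1 r] by (intro card_mono) auto
  ultimately show ?thesis
    using False assms by (auto simp: halving_weight_def intro!: frac_le power_increasing)
qed

text \<open>One application of \<open>\<alpha>\<close> shifts the signed count by at least one: for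
  \<open>s > 1\<close> the orbit loses its initial entry above 1, and for \<open>s \<le> 1\<close>
  the orbit of 1 gains an entry that is at least the new point.\<close>

lemma halving_weight_step:
  assumes "0 \<le> s"
  shows "halving_weight (\<alpha> s) \<le> halving_weight s / 2"
proof (cases "s = 0")
  case True
  then show ?thesis by (simp add: halving_weight_def class_K_zero[OF K])
next
  case False
  define P Q where "P s = card {k. 1 < (\<alpha> ^^ k) s}" and "Q s = card {k. s \<le> (\<alpha> ^^ k) 1}" for s
  have s: "0 < s" "0 < \<alpha> s" using False assms class_K_pos[OF K, of s] by auto
  have shift: "(\<alpha> ^^ Suc k) r = (\<alpha> ^^ k) (\<alpha> r)" for k r by (simp add: funpow_swap1)
  \<comment> \<open>This says that \<open>P - Q\<close> drops by at least one, arranged without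
    subtraction on the naturals.\<close>
  have "P (\<alpha> s) + Q s + 1 \<le> P s + Q (\<alpha> s)"
  proof (cases "s \<le> 1")
    case True
    have "(\<alpha> ^^ k) r \<le> 1" if "0 \<le> r" "r \<le> 1" for k r
      using decseqD[OF iterate_decseq[OF that(1)], of 0 k] that by simp
    then have "P (\<alpha> s) = 0"
      using True s le_id[of s] by (simp add: P_def not_less[symmetric])
    moreover have "Suc (Q s) \<le> Q (\<alpha> s)"
    proof -
      have "insert 0 (Suc ` {k. s \<le> (\<alpha> ^^ k) 1}) \<subseteq> {k. \<alpha> s \<le> (\<alpha> ^^ k) 1}"
        using True s le_id[of s] by (auto intro!: class_K_mono[OF K])
      then have "card (insert 0 (Suc ` {k. s \<le> (\<alpha> ^^ k) 1})) \<le> Q (\<alpha> s)"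
        unfolding Q_def using finite_iterate_ge[of 1 "\<alpha> s"] s by (intro card_mono) auto
      then show ?thesis
        using finite_iterate_ge[of 1 s] s by (simp add: Q_def card_image)
    qed
    ultimately show ?thesis by simp
  next
    case False
    have "{k. s \<le> (\<alpha> ^^ k) 1} = {}"
      using False decseqD[OF iterate_decseq[of 1], of 0] by (auto dest: order_trans)
    then have "Q s = 0" unfolding Q_def by simp
    moreover have "Suc (P (\<alpha> s)) \<le> P s"
    proof -
      have "insert 0 (Suc ` {k. 1 < (\<alpha> ^^ k) (\<alpha> s)}) \<subseteq> {k. 1 < (\<alpha> ^^ k) s}"
        using False by (auto simp flip: shift)
      then have "card (insert 0 (Suc ` {k. 1 < (\<alpha> ^^ k) (\<alpha> s)})) \<le> P s"
        unfolding P_def using finite_iterate_gt_1[of s] s by (intro card_mono) auto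
      then show ?thesis
        using finite_iterate_gt_1[of "\<alpha> s"] s by (simp add: P_def card_image)
    qed
    ultimately show ?thesis by simp
  qed
  then have "(2::real) ^ (P (\<alpha> s) + Q s + 1) \<le> 2 ^ (P s + Q (\<alpha> s))"
    by (rule power_increasing) simp
  then show ?thesis
    using s by (simp add: halving_weight_def P_def Q_def power_add field_simps)
qed

lemma halving_weight_iterate:
  assumes "0 \<le> s"
  shows "halving_weight ((\<alpha> ^^ k) s) \<le> halving_weight s / 2 ^ k"
proof (induction k)
  case (Suc k)
  have "halving_weight ((\<alpha> ^^ Suc k) s) \<le> halving_weight ((\<alpha> ^^ k) s) / 2"
    using halving_weight_step[OF iterate_nonneg[OF assms], of k] by simp
  also have "\<dots> \<le> halving_weight s / 2 ^ k / 2" using Suc by (simp add: divide_right_mono)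
  finally show ?case by simp
qed simp

lemma integrable_halving_weight: "halving_weight integrable_on {a..b}"
  by (intro integrable_on_mono_on mono_onI halving_weight_mono)

text \<open>The weight halves along orbits but may jump; integrating it restores continuity, and
  monotonicity of the weight keeps the integral comparable to its values at endpoints.\<close>

definition halving_integral :: "real \<Rightarrow> real" where
  "halving_integral s = integral {0..s} halving_weight"

lemma halving_integral_diff:
  assumes "0 \<le> a" "a \<le> b"
  shows "(b - a) * halving_weight a \<le> halving_integral b - halving_integral a"
    and "halving_integral b - halving_integral a \<le> (b - a) * halving_weight b"
proof -
  have eq: "halving_integral b - halving_integral a = integral {a..b} halving_weight"
    unfolding halving_integral_def
    using Henstock_Kurzweil_Integration.integral_combine[OF assms integrable_halving_weight] by simp
  have "integral {a..b} (\<lambda>_. halving_weight a) \<le> integral {a..b} halving_weight"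
    by (intro integral_le integrable_halving_weight) (auto intro: halving_weight_mono)
  then show "(b - a) * halving_weight a \<le> halving_integral b - halving_integral a"
    using assms eq by simp
  have "integral {a..b} halving_weight \<le> integral {a..b} (\<lambda>_. halving_weight b)"
    by (intro integral_le integrable_halving_weight) (auto intro: halving_weight_mono)
  then show "halving_integral b - halving_integral a \<le> (b - a) * halving_weight b"
    using assms eq by simp
qed

lemma halving_integral_0: "halving_integral 0 = 0"
  by (simp add: halving_integral_def)

lemma halving_integral_Kinf: "halving_integral \<in> class_Kinf"
  unfolding class_Kinf_iff
proof (intro conjI allI class_KI)
  show "continuous_on {0..} halving_integral"
  proof (rule continuous_on_eq_continuous_within[THEN iffD2], rule ballI)
    fix x :: real
    assume x: "x \<in> {0..}"
    have "continuous_on {0..x + 1} halving_integral"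
      unfolding halving_integral_def by (rule indefinite_integral_continuous_1[OF integrable_halving_weight])
    then have "continuous (at x within {0..x + 1}) halving_integral"
      using x by (auto simp: continuous_on_eq_continuous_within)
    moreover have "at x within {0..x + 1} = at x within {0..}"
      by (rule at_within_nhd[where S = "{x - 1<..<x + 1}"]) auto
    ultimately show "continuous (at x within {0..}) halving_integral" by simp
  qed
  show "halving_integral x < halving_integral y" if "0 \<le> x" "x < y" for x y
  proof -
    \<comment> \<open>The weight vanishes at 0, so for \<open>x = 0\<close> its value at the left
      endpoint gives no strict growth. The midpoint is positive in every case.\<close>
    define z where "z = (x + y) / 2"
    have z: "x < z" "z < y" using that by (auto simp: z_def)
    have "0 < (y - z) * halving_weight z"
      using z that halving_weight_pos[of z] by (intro mult_pos_pos) auto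
    moreover have "0 \<le> (z - x) * halving_weight x"
      using z halving_weight_nonneg[of x] by simp
    ultimately show ?thesis
      using halving_integral_diff(1)[of x z] halving_integral_diff(1)[of z y] z that by linarith
  qed
  show "\<exists>x\<ge>0. y \<le> halving_integral x" for y
  proof -
    have p: "0 < halving_weight 1" by (rule halving_weight_pos) simp
    \<comment> \<open>Beyond 1 the integral grows with slope at least
      \<open>halving_weight 1\<close>, and this point suffices to gain
      \<open>\<bar>y\<bar>\<close>.\<close>
    define x where "x = 1 + \<bar>y\<bar> / halving_weight 1"
    have "(1 - 0) * halving_weight 0 \<le> halving_integral 1 - halving_integral 0"
      by (rule halving_integral_diff) auto
    moreover have "(x - 1) * halving_weight 1 \<le> halving_integral x - halving_integral 1"
      using p by (intro halving_integral_diff) (auto simp: x_def)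
    moreover have "(x - 1) * halving_weight 1 = \<bar>y\<bar>" using p by (simp add: x_def)
    ultimately have "y \<le> halving_integral x"
      using halving_integral_0 halving_weight_nonneg[of 0] by simp
    then show ?thesis using p by (intro exI[of _ x]) (auto simp: x_def)
  qed
qed (rule halving_integral_0)

text \<open>The integral up to an iterate is at most its length times the weight there, and the
  weights decay like powers of 1/2. The resulting bound by the weight at \<open>s\<close> need not
  be continuous in \<open>s\<close>; integrating over the interval from \<open>s\<close> to
  \<open>2 * s\<close> turns it back into a comparison function.\<close>

lemma sum_halving_integral_iterate_le:
  assumes s: "0 \<le> s"
  shows "(\<Sum>k<n. halving_integral ((\<alpha> ^^ k) s)) \<le> 2 * halving_integral (2 * s)"
proof -
  have "halving_integral ((\<alpha> ^^ k) s) \<le> (1 / 2) ^ k * (s * halving_weight s)" for k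
  proof -
    define y where "y = (\<alpha> ^^ k) s"
    have y: "0 \<le> y" "y \<le> s"
      using iterate_nonneg[OF s] decseqD[OF iterate_decseq[OF s], of 0 k] by (auto simp: y_def)
    have "halving_integral y \<le> y * halving_weight y"
      using halving_integral_diff(2)[of 0 y] y by (simp add: halving_integral_0)
    also have "\<dots> \<le> s * (halving_weight s / 2 ^ k)"
      using y s halving_weight_iterate[OF s, of k] halving_weight_nonneg[of y]
      by (intro mult_mono) (auto simp: y_def)
    finally show ?thesis by (simp add: y_def power_divide mult_ac)
  qed
  then have "(\<Sum>k<n. halving_integral ((\<alpha> ^^ k) s)) \<le> (\<Sum>k<n. (1 / 2) ^ k * (s * halving_weight s))"
    by (intro sum_mono)
  also have "\<dots> = (\<Sum>k<n. (1 / 2) ^ k) * (s * halving_weight s)"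
    by (simp add: sum_distrib_right)
  also have "\<dots> \<le> 2 * (s * halving_weight s)"
    using geometric_partial_sum_le[of "1 / 2" n] s halving_weight_nonneg[of s]
    by (intro mult_right_mono) auto
  also have "s * halving_weight s \<le> halving_integral (2 * s)"
  proof -
    have "s * halving_weight s \<le> halving_integral (2 * s) - halving_integral s"
      using halving_integral_diff(1)[of s "2 * s"] s by simp
    moreover have "0 \<le> halving_integral s"
      using class_K_nonneg[OF class_Kinf_imp_K[OF halving_integral_Kinf] s] .
    ultimately show ?thesis by simp
  qed
  finally show ?thesis by simp
qed

end

section \<open>Stability of the closed loop\<close>

text \<open>Adding 1 to the logarithmic quotient gives \<open>ln \<gamma>\<close> over the same
  denominator, so the hypothesis is the logarithm of the power inequality with exponent
  \<open>N - 1\<close>.\<close>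

lemma log_horizon_bound:
  fixes \<gamma> :: real
  assumes "1 < \<gamma>" "real N > 2 + ln (\<gamma> - 1) / (ln \<gamma> - ln (\<gamma> - 1))"
  shows "2 \<le> N" "\<gamma> < (\<gamma> / (\<gamma> - 1)) ^ (N - 1)"
proof -
  define D where "D = ln \<gamma> - ln (\<gamma> - 1)"
  have D: "0 < D" using assms(1) by (simp add: D_def)
  have "1 + ln (\<gamma> - 1) / D = ln \<gamma> / D"
    using D by (simp add: D_def field_simps)
  then have gt: "ln \<gamma> / D < real N - 1"
    using assms(2) by (simp add: D_def)
  moreover have "0 < ln \<gamma> / D" using D assms(1) by simp
  ultimately show N: "2 \<le> N" by linarith
  have "ln \<gamma> < real (N - 1) * D"
    using gt D N by (simp add: of_nat_diff field_simps)
  also have "\<dots> = ln ((\<gamma> / (\<gamma> - 1)) ^ (N - 1))"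
    using assms(1) by (simp add: D_def ln_realpow ln_div)
  finally show "\<gamma> < (\<gamma> / (\<gamma> - 1)) ^ (N - 1)"
    using assms(1) by (subst (asm) ln_less_cancel_iff) auto
qed

text \<open>This serves the cases of linear growth in which \<open>\<gamma>\<close> need not be a
  cost bound: the first entry of \<open>q\<close> alone acts as an admissible feedback of length one
  with linear decay.\<close>

lemma asymptotically_stable_one_step:
  fixes c :: real
  assumes a1: "a1 \<in> class_Kinf" and a2: "a2 \<in> class_Kinf" and \<omega>: "\<And>x. 0 \<le> \<omega> x"
    and V: "\<And>x. 0 \<le> V x" "\<And>x. a1 (\<omega> x) \<le> V x \<and> V x \<le> a2 (\<omega> x)"
    and adm: "admissible_fs_feedback g X U M \<omega> q" "1 \<le> M" and c: "0 \<le> c" "c < 1"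
    and decay: "\<And>\<xi>. \<xi> \<in> X \<Longrightarrow> V (sol g \<xi> (q \<xi>) 1) \<le> c * V \<xi>"
    and N: "2 \<le> N" and fb: "mpc_feedback g X U V N \<mu>"
  shows "asymptotically_stable g X \<omega> \<mu>"
proof -
  have adm1: "admissible_fs_feedback g X U 1 \<omega> q"
    unfolding admissible_fs_feedback_def
  proof (intro conjI ballI allI impI)
    show "q \<xi> j \<in> U" if "\<xi> \<in> X" "j < 1" for \<xi> j
      using adm that by (simp add: admissible_fs_feedback_def)
    show "sol g \<xi> (q \<xi>) j \<in> X" if "\<xi> \<in> X" "j \<in> {1..1}" for \<xi> j
      using adm that by (simp add: admissible_fs_feedback_def del: sol.simps)
    show "\<exists>\<kappa>\<in>class_K. \<forall>\<xi>\<in>X. \<omega> (sol g \<xi> (q \<xi>) j) \<le> \<kappa> (\<omega> \<xi>)" if "j \<in> {1..1}" for j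
      using adm that by (simp add: admissible_fs_feedback_def del: sol.simps)
  qed
  have "fs_decay g X 1 V q (\<lambda>s. c * s)"
    using decay unfolding fs_decay_def by (simp add: fs_input_def)
  note block = fs_block_decay_linear[of g X U 1 \<omega> q _ V c, OF adm1 order_refl _ this V(1) c(1)]
  have bound: "cost_bound g X U V k (\<lambda>r. (\<Sum>i<k. c ^ i) * r)" for k
    by (rule cost_bound_fs_feedback[of g X U 1 \<omega> q V "\<lambda>k r. c ^ k * r", OF adm1 order_refl V(1)])
      (use block in \<open>auto simp: sum_distrib_right\<close>)
  \<comment> \<open>The cost bound used here depends on \<open>N\<close>, which is harmless because
    asymptotic stability is claimed for a fixed horizon.\<close>
  show ?thesis
  proof (rule asymptotically_stable_if_descent[of a1 a2 \<omega> V "1 - c" "\<lambda>r. (\<Sum>i<N. c ^ i) * r",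
        OF a1 a2 \<omega> V])
    have "0 < (\<Sum>i<N. c ^ i)"
      using c N by (intro sum_pos2[of _ 0]) auto
    then show "(\<lambda>r. (\<Sum>i<N. c ^ i) * r) \<in> class_Kinf" by (rule class_Kinf_linear)
  qed (use c N bound fb descent_one_step[of c N g X U V, OF c N bound V(1)] in auto)
qed

text \<open>The descent fraction \<open>\<nu>\<close> is positive because the power of
  \<open>\<gamma> / (\<gamma> - 1)\<close> exceeds \<open>\<gamma>\<close>.\<close>

lemma asymptotically_stable_linear:
  assumes a1: "a1 \<in> class_Kinf" and a2: "a2 \<in> class_Kinf" and \<omega>: "\<And>x. 0 \<le> \<omega> x"
    and V: "\<And>x. 0 \<le> V x" "\<And>x. a1 (\<omega> x) \<le> V x \<and> V x \<le> a2 (\<omega> x)"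
    and \<gamma>: "1 < \<gamma>" and bound: "\<And>k. cost_bound g X U V k (\<lambda>r. \<gamma> * r)"
    and N: "2 \<le> N" "\<gamma> < (\<gamma> / (\<gamma> - 1)) ^ (N - 1)" and fb: "mpc_feedback g X U V N \<mu>"
  shows "asymptotically_stable g X \<omega> \<mu>"
proof -
  define \<nu> where "\<nu> = 1 - (\<gamma> - 1) / ((\<gamma> / (\<gamma> - 1)) ^ (N - 1) - 1)"
  have "(\<gamma> - 1) / ((\<gamma> / (\<gamma> - 1)) ^ (N - 1) - 1) < 1"
    using \<gamma> N(2) by (subst divide_less_eq_1_pos) auto
  moreover have "0 \<le> (\<gamma> - 1) / ((\<gamma> / (\<gamma> - 1)) ^ (N - 1) - 1)"
    using \<gamma> N(2) by (intro divide_nonneg_nonneg) auto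
  ultimately have \<nu>: "0 < \<nu>" "\<nu> \<le> 1" unfolding \<nu>_def by auto
  have B: "(\<lambda>r. \<gamma> * r) \<in> class_Kinf" using \<gamma> by (intro class_Kinf_linear) simp
  show ?thesis
    using asymptotically_stable_if_descent[of a1 a2 \<omega> V \<nu> "\<lambda>r. \<gamma> * r" N g X U \<mu>,
        OF a1 a2 \<omega> V \<nu> B _ bound fb]
      descent_linear[of \<gamma> N g X U V, OF \<gamma> N bound V(1), folded \<nu>_def] N(1) by simp
qed

lemma powr_geometric_sum_le:
  fixes c r a :: real
  assumes "0 < c" "c < 1" "0 < a" "0 \<le> r"
  shows "(\<Sum>k<n. (c ^ k * r) powr a) \<le> 1 / (1 - c powr a) * r powr a"
proof -
  have c: "0 \<le> c powr a" "c powr a < 1"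
    using assms powr_less_mono2[of a c 1] by auto
  have "(c ^ k) powr a = (c powr a) ^ k" for k
    using assms(1) by (simp add: powr_powr mult.commute flip: powr_realpow)
  then have "(\<Sum>k<n. (c ^ k * r) powr a) = (\<Sum>k<n. (c powr a) ^ k) * r powr a"
    using assms by (simp add: powr_mult sum_distrib_right)
  also have "\<dots> \<le> 1 / (1 - c powr a) * r powr a"
    using geometric_partial_sum_le[OF c] by (intro mult_right_mono) auto
  finally show ?thesis .
qed

theorem theorem22:
  fixes g :: "real ^ 'n \<Rightarrow> real ^ 'm \<Rightarrow> real ^ 'n"
    and X :: "(real ^ 'n) set" and U :: "(real ^ 'm) set"
    and \<omega> \<omega>1 V :: "real ^ 'n \<Rightarrow> real" and \<omega>2 :: "real ^ 'm \<Rightarrow> real"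
    and M :: nat
    and q :: "real ^ 'n \<Rightarrow> nat \<Rightarrow> real ^ 'm"
    and \<alpha> \<kappa>h :: "real \<Rightarrow> real"
  assumes "continuous_on (X \<times> U) (\<lambda>(x, u). g x u)"
    and "measurement_function \<omega>1" and "measurement_function \<omega>2"
    and "K_bounded_on X U \<omega>1 \<omega>2 g"
    and "M \<ge> 1"
    and "measurement_function \<omega>"
    and "fs_clf g X U M \<omega> V q \<alpha>"
    and "\<kappa>h \<in> class_Kinf"
    and "\<forall>\<xi>\<in>X. \<forall>i\<in>{1..M - 1}. V (sol g \<xi> (q \<xi>) i) \<le> \<kappa>h (V \<xi>)"
  shows
    "(\<forall>c d \<gamma> :: real. 0 \<le> c \<and> c < 1 \<and> 0 < d
        \<and> fs_decay g X M V q (\<lambda>s. c * s) \<and> (\<forall>r\<ge>0. \<kappa>h r = d * r)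
        \<and> \<gamma> = real M * d / (1 - c) \<and> 1 < \<gamma> \<longrightarrow>
        (\<forall>N::nat. N \<ge> 1 \<and> real N > 2 + ln (\<gamma> - 1) / (ln \<gamma> - ln (\<gamma> - 1)) \<longrightarrow>
          (\<forall>\<mu>. mpc_feedback g X U V N \<mu> \<longrightarrow> asymptotically_stable g X \<omega> \<mu>)))
   \<and> (\<forall>c a b p :: real. 0 \<le> c \<and> c < 1 \<and> 0 < a \<and> 0 < b \<and> 0 < p
        \<and> fs_decay g X M V q (\<lambda>s. c * s) \<and> (\<forall>r\<ge>0. \<kappa>h r \<le> p * max (r powr a) (r powr b)) \<longrightarrow>
        (\<forall>\<mu>. (\<forall>N\<ge>1. mpc_feedback g X U V N (\<mu> N)) \<longrightarrow>
          semiglobally_practically_stabilizing g X \<omega> \<mu>))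
   \<and> ((\<forall>\<rho>\<in>class_Kinf. \<forall>N\<ge>1. \<forall>\<xi>\<in>X. \<exists>u. ocp_optimal g X U (\<lambda>x. \<rho> (V x)) N \<xi> u) \<longrightarrow>
        (\<exists>\<rho>\<in>class_Kinf. \<forall>\<mu>. (\<forall>N\<ge>1. mpc_feedback g X U (\<lambda>x. \<rho> (V x)) N (\<mu> N)) \<longrightarrow>
          semiglobally_practically_stabilizing g X \<omega> \<mu>))"
proof -
  have \<omega>: "0 \<le> \<omega> x" for x using assms(6) by (simp add: measurement_function_def)
  obtain a1 a2 where a: "a1 \<in> class_Kinf" "a2 \<in> class_Kinf"
    and V2: "\<And>x. a1 (\<omega> x) \<le> V x \<and> V x \<le> a2 (\<omega> x)"
    using assms(7) unfolding fs_clf_def by blast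
  have V: "0 \<le> V x" for x using assms(7) by (simp add: fs_clf_def)
  have adm: "admissible_fs_feedback g X U M \<omega> q" and \<alpha>: "\<alpha> \<in> class_Kinf" "\<And>s. 0 < s \<Longrightarrow> \<alpha> s < s"
    and decay: "fs_decay g X M V q \<alpha>"
    using assms(7) by (auto simp: fs_clf_def)
  have M: "1 \<le> M" by (rule assms(5))
  have T: "V (sol g \<xi> (q \<xi>) i) \<le> \<kappa>h (V \<xi>)" if "\<xi> \<in> X" "1 \<le> i" "i < M" for \<xi> i
    using assms(9) that by auto
  note K\<kappa> = class_Kinf_imp_K[OF assms(8)] and K\<alpha> = class_Kinf_imp_K[OF \<alpha>(1)]
  \<comment> \<open>Adding \<open>V \<xi>\<close> also covers \<open>i = 0\<close>, the start of a
    block, about which (T) says nothing.\<close>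
  have T': "V (sol g \<xi> (q \<xi>) i) \<le> V \<xi> + \<kappa>h (V \<xi>)" if "\<xi> \<in> X" "i < M" for \<xi> i
    using T[OF that(1) _ that(2)] V[of \<xi>] class_K_nonneg[OF K\<kappa> V, of \<xi>] by (cases "i = 0") auto
  have part1: "asymptotically_stable g X \<omega> \<mu>"
    if c: "0 \<le> c" "c < 1" and d: "0 < d" and dec: "fs_decay g X M V q (\<lambda>s. c * s)"
      and \<kappa>: "\<forall>r\<ge>0. \<kappa>h r = d * r" and \<gamma>: "\<gamma> = real M * d / (1 - c)" "1 < \<gamma>"
      and N: "real N > 2 + ln (\<gamma> - 1) / (ln \<gamma> - ln (\<gamma> - 1))"
      and fb: "mpc_feedback g X U V N \<mu>" for c d \<gamma> :: real and N :: nat and \<mu>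
  proof -
    note N' = log_horizon_bound[OF \<gamma>(2) N]
    note one_step = asymptotically_stable_one_step[OF a \<omega> V V2 adm M _ _ _ N'(1) fb]
    \<comment> \<open>For \<open>d < 1\<close>, \<open>\<gamma>\<close> need not bound the cost, because the initial stage cost \<open>V \<xi>\<close> is not covered
      by \<open>d V \<xi>\<close>. For \<open>M = 1\<close>, (T) is void. In both cases \<open>V\<close> already decays in one step.\<close>
    consider "M = 1" | "M \<ge> 2" "d < 1" | "d \<ge> 1" using M by linarith
    then show ?thesis
    proof cases
      case 1
      then have "V (sol g \<xi> (q \<xi>) 1) \<le> c * V \<xi>" if "\<xi> \<in> X" for \<xi>
        using dec that by (simp add: fs_decay_def fs_input_def)
      then show ?thesis using one_step c by blast
    next
      case 2
      then have "V (sol g \<xi> (q \<xi>) 1) \<le> d * V \<xi>" if "\<xi> \<in> X" for \<xi>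
        using T[OF that, of 1] \<kappa> V[of \<xi>] by simp
      then show ?thesis using one_step[of d] d 2 by simp
    next
      case 3
      have "cost_bound g X U V k (\<lambda>r. \<gamma> * r)" for k
      proof (rule cost_bound_fs_feedback[of g X U M \<omega> q V "\<lambda>k r. d * (c ^ k * r)", OF adm M V])
        fix \<xi> k i
        assume \<xi>: "\<xi> \<in> X" and i: "i < M"
        define y where "y = fs_block g M q \<xi> k"
        have y: "y \<in> X" unfolding y_def by (rule fs_block_in[OF adm M \<xi>])
        have "V (sol g y (q y) i) \<le> d * V y"
        \<comment> \<open>The start of the block is bounded by \<open>d\<close> times itself because
          \<open>d \<ge> 1\<close>.\<close>
        proof (cases "i = 0")
          case True
          then show ?thesis using 3 V[of y] by (simp add: mult_le_cancel_right1)
        next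
          case False
          then show ?thesis using T[OF y _ i] \<kappa> V[of y] by simp
        qed
        also have "\<dots> \<le> d * (c ^ k * V \<xi>)"
          using fs_block_decay_linear[of g X U M \<omega> q \<xi> V c k, OF adm M \<xi> dec V c(1)] d
          by (simp add: y_def)
        finally show "V (sol g (fs_block g M q \<xi> k) (q (fs_block g M q \<xi> k)) i) \<le> d * (c ^ k * V \<xi>)"
          by (simp add: y_def)
      next
        fix r :: real
        assume r: "0 \<le> r"
        have "real M * (\<Sum>i<k. d * (c ^ i * r)) = real M * d * r * (\<Sum>i<k. c ^ i)"
          by (simp add: sum_distrib_left mult_ac)
        also have "\<dots> \<le> real M * d * r * (1 / (1 - c))"
          using r d geometric_partial_sum_le[OF c] by (intro mult_left_mono) auto
        finally show "real M * (\<Sum>i<k. d * (c ^ i * r)) \<le> \<gamma> * r" by (simp add: \<gamma>(1))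
      qed
      then show ?thesis
        using asymptotically_stable_linear[of a1 a2 \<omega> V \<gamma>, OF a \<omega> V V2 \<gamma>(2) _ N' fb] by blast
    qed
  qed
  have part2: "semiglobally_practically_stabilizing g X \<omega> \<mu>"
    if c: "0 \<le> c" "c < 1" and ab: "0 < a" "0 < b" "0 < p" and dec: "fs_decay g X M V q (\<lambda>s. c * s)"
      and \<kappa>: "\<forall>r\<ge>0. \<kappa>h r \<le> p * max (r powr a) (r powr b)"
      and fb: "\<forall>N\<ge>1. mpc_feedback g X U V N (\<mu> N)" for c a b p :: real and \<mu>
  proof -
    \<comment> \<open>The ratio \<open>c\<close> may be 0, while the geometric sum of powers asks
      for a positive ratio; enlarging it below 1 keeps the decay valid.\<close>
    define e where "e = max c (1 / 2)"
    have e: "0 < e" "e < 1" "0 \<le> e" using c by (auto simp: e_def)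
    have "fs_decay g X M V q (\<lambda>s. e * s)"
      using dec V unfolding fs_decay_def
      by (auto simp: e_def intro: order_trans[OF _ mult_right_mono])
    note block = fs_block_decay_linear[of g X U M \<omega> q _ V e, OF adm M _ this V e(3)]
    have ea: "e powr a < 1" "e powr b < 1"
      using e ab powr_less_mono2[of a e 1] powr_less_mono2[of b e 1] by auto
    \<comment> \<open>The maximum of the two powers is replaced by their sum, so that summing over
      blocks splits into three geometric series; \<open>B\<close> collects their limits and is again
      of class K-infinity.\<close>
    define f where "f k r = e ^ k * r + p * ((e ^ k * r) powr a + (e ^ k * r) powr b)" for k r
    define B where "B r = real M * (1 / (1 - e) * r
      + (p * (1 / (1 - e powr a) * r powr a) + p * (1 / (1 - e powr b) * r powr b)))" for r
    have "B \<in> class_Kinf"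
      unfolding B_def using M e ab ea
      by (intro class_Kinf_cmult class_Kinf_add class_Kinf_linear class_Kinf_powr
          class_Kinf_imp_K) auto
    moreover have "cost_bound g X U V k B" for k
    proof (rule cost_bound_fs_feedback[of g X U M \<omega> q V f, OF adm M V])
      fix \<xi> k i
      assume \<xi>: "\<xi> \<in> X" and i: "i < M"
      define y where "y = fs_block g M q \<xi> k"
      have y: "y \<in> X" unfolding y_def by (rule fs_block_in[OF adm M \<xi>])
      have "V y \<le> e ^ k * V \<xi>" using block[OF \<xi>] by (simp add: y_def)
      then have "V y + p * (V y powr a + V y powr b) \<le> f k (V \<xi>)"
        unfolding f_def using V[of y] ab
        by (intro add_mono mult_left_mono powr_mono2) auto
      moreover have "\<kappa>h (V y) \<le> p * (V y powr a + V y powr b)"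
      proof -
        have "p * max (V y powr a) (V y powr b) \<le> p * (V y powr a + V y powr b)"
          using ab by (intro mult_left_mono) auto
        then show ?thesis using \<kappa> V[of y] by (meson order_trans)
      qed
      ultimately show "V (sol g (fs_block g M q \<xi> k) (q (fs_block g M q \<xi> k)) i) \<le> f k (V \<xi>)"
        using T'[OF y i] unfolding y_def by linarith
    next
      fix r :: real
      assume r: "0 \<le> r"
      have "(\<Sum>i<k. f i r) = (\<Sum>i<k. e ^ i) * r
          + (p * (\<Sum>i<k. (e ^ i * r) powr a) + p * (\<Sum>i<k. (e ^ i * r) powr b))"
        unfolding f_def by (simp add: sum.distrib sum_distrib_left sum_distrib_right distrib_left)
      also have "\<dots> \<le> 1 / (1 - e) * r
          + (p * (1 / (1 - e powr a) * r powr a) + p * (1 / (1 - e powr b) * r powr b))"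
        using r ab e geometric_partial_sum_le[OF e(3,2), of k]
        by (intro add_mono mult_left_mono mult_right_mono powr_geometric_sum_le) auto
      finally show "real M * (\<Sum>i<k. f i r) \<le> B r"
        unfolding B_def by (intro mult_left_mono) auto
    qed
    ultimately show ?thesis
      using semiglobally_practically_stabilizing_if_cost_bound[of a1 a2 \<omega> V B g X U \<mu>,
          OF a \<omega> V V2] fb by blast
  qed
  have part3: "\<exists>\<rho>\<in>class_Kinf. \<forall>\<mu>. (\<forall>N\<ge>1. mpc_feedback g X U (\<lambda>x. \<rho> (V x)) N (\<mu> N)) \<longrightarrow>
      semiglobally_practically_stabilizing g X \<omega> \<mu>"
  proof -
    define \<sigma> where "\<sigma> = halving_integral \<alpha>"
    note \<sigma> = halving_integral_Kinf[OF K\<alpha> \<alpha>(2), folded \<sigma>_def]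
    note \<sigma>_sum = sum_halving_integral_iterate_le[OF K\<alpha> \<alpha>(2), folded \<sigma>_def]
    \<comment> \<open>By \<open>T'\<close>, \<open>\<eta>\<close> bounds all stage costs within a
      block through the value of \<open>V\<close> at the block's start.\<close>
    define \<eta> where "\<eta> s = 1 * s + \<kappa>h s" for s
    have \<eta>: "\<eta> \<in> class_Kinf"
      unfolding \<eta>_def by (intro class_Kinf_add class_Kinf_linear K\<kappa>) simp
    obtain \<theta> where \<theta>: "\<theta> \<in> class_Kinf" "\<And>s. 0 \<le> s \<Longrightarrow> \<theta> (\<eta> s) = s"
      using class_Kinf_inverse[OF \<eta>] by metis
    \<comment> \<open>\<open>\<rho> \<circ> \<eta> = \<sigma>\<close> absorbs the growth (T) within a block; \<open>\<sigma>\<close> is summable along the iterates of \<open>\<alpha>\<close>.\<close>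
    define \<rho> where "\<rho> s = \<sigma> (\<theta> s)" for s
    have \<rho>: "\<rho> \<in> class_Kinf" unfolding \<rho>_def by (rule class_Kinf_comp[OF \<sigma> \<theta>(1)])
    \<comment> \<open>A cost bound must be expressed through the new stage cost
      \<open>\<rho> (V \<xi>)\<close>; its inverse recovers \<open>V \<xi>\<close>, on which the
      iterates of \<open>\<alpha>\<close> act.\<close>
    obtain \<tau> where \<tau>: "\<tau> \<in> class_Kinf" "\<And>s. 0 \<le> s \<Longrightarrow> \<tau> (\<rho> s) = s"
      using class_Kinf_inverse[OF \<rho>] by metis
    note K\<rho> = class_Kinf_imp_K[OF \<rho>] and K\<sigma> = class_Kinf_imp_K[OF \<sigma>]
      and K\<tau> = class_Kinf_imp_K[OF \<tau>(1)]
    define W where "W x = \<rho> (V x)" for x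
    have W: "0 \<le> W x" for x unfolding W_def by (rule class_K_nonneg[OF K\<rho> V])
    have W2: "\<rho> (a1 (\<omega> x)) \<le> W x \<and> W x \<le> \<rho> (a2 (\<omega> x))" for x
      unfolding W_def using V2[of x] V[of x] class_K_nonneg[OF class_Kinf_imp_K[OF a(1)] \<omega>]
      by (auto intro!: class_K_mono[OF K\<rho>])
    define B where "B r = real M * (2 * \<sigma> (2 * \<tau> r))" for r
    have B: "B \<in> class_Kinf"
      unfolding B_def using M
      by (intro class_Kinf_cmult class_Kinf_comp[OF \<sigma>] \<tau>(1)) auto
    have bound: "cost_bound g X U W k B" for k
    proof (rule cost_bound_fs_feedback[of g X U M \<omega> q W "\<lambda>k r. \<sigma> ((\<alpha> ^^ k) (\<tau> r))", OF adm M W])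
      fix \<xi> k i
      assume \<xi>: "\<xi> \<in> X" and i: "i < M"
      define y where "y = fs_block g M q \<xi> k"
      have y: "y \<in> X" unfolding y_def by (rule fs_block_in[OF adm M \<xi>])
      have "W (sol g y (q y) i) \<le> \<rho> (\<eta> (V y))"
        unfolding W_def using T'[OF y i] by (intro class_K_mono[OF K\<rho> V]) (simp add: \<eta>_def)
      also have "\<dots> = \<sigma> (V y)" by (simp add: \<rho>_def \<theta>(2)[OF V])
      also have "\<dots> \<le> \<sigma> ((\<alpha> ^^ k) (V \<xi>))"
        using fs_block_decay[of g X U M \<omega> q \<xi> V \<alpha> k, OF adm M \<xi> decay V class_K_mono[OF K\<alpha>]]
        unfolding y_def by (intro class_K_mono[OF K\<sigma> V])
      finally show "W (sol g (fs_block g M q \<xi> k) (q (fs_block g M q \<xi> k)) i)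
          \<le> \<sigma> ((\<alpha> ^^ k) (\<tau> (W \<xi>)))"
        by (simp add: y_def W_def \<tau>(2)[OF V])
    next
      fix r :: real
      assume "0 \<le> r"
      then have "(\<Sum>i<k. \<sigma> ((\<alpha> ^^ i) (\<tau> r))) \<le> 2 * \<sigma> (2 * \<tau> r)"
        by (intro \<sigma>_sum class_K_nonneg[OF K\<tau>])
      then show "real M * (\<Sum>i<k. \<sigma> ((\<alpha> ^^ i) (\<tau> r))) \<le> B r"
        unfolding B_def by (intro mult_left_mono) auto
    qed
    have "semiglobally_practically_stabilizing g X \<omega> \<mu>"
      if "\<forall>N\<ge>1. mpc_feedback g X U (\<lambda>x. \<rho> (V x)) N (\<mu> N)" for \<mu>
      using semiglobally_practically_stabilizing_if_cost_bound[of "\<lambda>s. \<rho> (a1 s)" "\<lambda>s. \<rho> (a2 s)" \<omega> W B g X U \<mu>,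
          OF class_Kinf_comp[OF \<rho> a(1)] class_Kinf_comp[OF \<rho> a(2)] \<omega> W W2 B bound] that
      unfolding W_def by blast
    then show ?thesis using \<rho> by blast
  qed
  show ?thesis
  proof (intro conjI allI impI, goal_cases)
    case (1 c d \<gamma> N \<mu>)
    then show ?case using part1[of c d \<gamma> N \<mu>] by blast
  next
    case (2 c a b p \<mu>)
    then show ?case using part2[of c a b p \<mu>] by blast
  next
    case 3
    then show ?case using part3 by blast
  qed
qed

end
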